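(* Let $R$ be a ring and let $M$ be a left $R$-module. Suppose that $^\ast$ and $^\sharp$ are dualities each of which applies to $M$; that is, there are ring homomorphisms $S\to {\rm End}(M)$ and $T\to{\rm End}(M)$, an injective cogenerator $E$ for right $S$-modules and an injective cogenerator $F$ for right $T$-modules, with $M^\ast={\rm Hom}_S(M_S,E_S)$ and $M^\sharp={\rm Hom}_T(M_T,F_T)$, regarded as right $R$-modules. Then ${\rm Prod}(M^\ast)={\rm Prod}(M^\sharp)$.
   Context: Rings are associative with $1$. For a left $R$-module $M$, endomorphisms are written on the right, so that $M$ is an $R$-${\rm End}(M)$-bimodule. If $S\to{\rm End}(M)$ is a ring homomorphism, $M$ becomes an $R$-$S$-bimodule; if $E$ is an injective cogenerator for right $S$-modules, then ${\rm Hom}_S(-,E_S)$ is called a duality that applies to $M$, and ${\rm Hom}_S(M_S,E_S)$ is a right $R$-module via $(fr)(m)=f(rm)$. For a class (or a single module) $\mathcal X$, ${\rm Prod}(\mathcal X)$ denotes the closure of $\mathcal X$ under arbitrary direct products and direct summands (and isomorphism). *)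

theory Defs
  imports "HOL-Algebra.Module" "HOL-Library.Equipollence"
begin

section \<open>Modules over arbitrary rings\<close>

text \<open>
  The library locale \<open>module\<close> requires a commutative base ring, so left and right modules over an
  arbitrary associative ring with 1 are introduced here.  As for the library record, a module record
  extends \<open>ring\<close> only in order to carry an additive group: its multiplicative fields are never used.
\<close>

locale left_module = R?: ring R + M?: abelian_group M
  for R :: "('r, 'k) ring_scheme" (structure) and M :: "('r, 'm, 'z) module_scheme" (structure) +
  assumes smult_closed:
      "\<lbrakk>r \<in> carrier R; x \<in> carrier M\<rbrakk> \<Longrightarrow> r \<odot>\<^bsub>M\<^esub> x \<in> carrier M"
    and smult_l_distr:
      "\<lbrakk>r \<in> carrier R; s \<in> carrier R; x \<in> carrier M\<rbrakk> \<Longrightarrow>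
        (r \<oplus>\<^bsub>R\<^esub> s) \<odot>\<^bsub>M\<^esub> x = r \<odot>\<^bsub>M\<^esub> x \<oplus>\<^bsub>M\<^esub> s \<odot>\<^bsub>M\<^esub> x"
    and smult_r_distr:
      "\<lbrakk>r \<in> carrier R; x \<in> carrier M; y \<in> carrier M\<rbrakk> \<Longrightarrow>
        r \<odot>\<^bsub>M\<^esub> (x \<oplus>\<^bsub>M\<^esub> y) = r \<odot>\<^bsub>M\<^esub> x \<oplus>\<^bsub>M\<^esub> r \<odot>\<^bsub>M\<^esub> y"
    and smult_assoc:
      "\<lbrakk>r \<in> carrier R; s \<in> carrier R; x \<in> carrier M\<rbrakk> \<Longrightarrow>
        (r \<otimes>\<^bsub>R\<^esub> s) \<odot>\<^bsub>M\<^esub> x = r \<odot>\<^bsub>M\<^esub> (s \<odot>\<^bsub>M\<^esub> x)"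
    and smult_one: "x \<in> carrier M \<Longrightarrow> \<one>\<^bsub>R\<^esub> \<odot>\<^bsub>M\<^esub> x = x"

record ('r, 'm) rmodule = "'m ring" +
  rsmult :: "'m \<Rightarrow> 'r \<Rightarrow> 'm"  (infixl \<open>\<triangleleft>\<index>\<close> 70)

locale right_module = R?: ring R + M?: abelian_group M
  for R :: "('r, 'k) ring_scheme" (structure) and M :: "('r, 'm, 'z) rmodule_scheme" (structure) +
  assumes rsmult_closed:
      "\<lbrakk>x \<in> carrier M; r \<in> carrier R\<rbrakk> \<Longrightarrow> x \<triangleleft>\<^bsub>M\<^esub> r \<in> carrier M"
    and rsmult_l_distr:
      "\<lbrakk>x \<in> carrier M; y \<in> carrier M; r \<in> carrier R\<rbrakk> \<Longrightarrow>
        (x \<oplus>\<^bsub>M\<^esub> y) \<triangleleft>\<^bsub>M\<^esub> r = x \<triangleleft>\<^bsub>M\<^esub> r \<oplus>\<^bsub>M\<^esub> y \<triangleleft>\<^bsub>M\<^esub> r"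
    and rsmult_r_distr:
      "\<lbrakk>x \<in> carrier M; r \<in> carrier R; s \<in> carrier R\<rbrakk> \<Longrightarrow>
        x \<triangleleft>\<^bsub>M\<^esub> (r \<oplus>\<^bsub>R\<^esub> s) = x \<triangleleft>\<^bsub>M\<^esub> r \<oplus>\<^bsub>M\<^esub> x \<triangleleft>\<^bsub>M\<^esub> s"
    and rsmult_assoc:
      "\<lbrakk>x \<in> carrier M; r \<in> carrier R; s \<in> carrier R\<rbrakk> \<Longrightarrow>
        x \<triangleleft>\<^bsub>M\<^esub> (r \<otimes>\<^bsub>R\<^esub> s) = (x \<triangleleft>\<^bsub>M\<^esub> r) \<triangleleft>\<^bsub>M\<^esub> s"
    and rsmult_one: "x \<in> carrier M \<Longrightarrow> x \<triangleleft>\<^bsub>M\<^esub> \<one>\<^bsub>R\<^esub> = x"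

text \<open>Homomorphisms are extensional, so that equality of homomorphisms is equality on the carrier.\<close>

definition lmod_hom ::
  "('r, 'k) ring_scheme \<Rightarrow> ('r, 'a) module \<Rightarrow> ('r, 'b) module \<Rightarrow> ('a \<Rightarrow> 'b) set"
  where "lmod_hom R A B = {f \<in> carrier A \<rightarrow>\<^sub>E carrier B.
    (\<forall>x\<in>carrier A. \<forall>y\<in>carrier A. f (x \<oplus>\<^bsub>A\<^esub> y) = f x \<oplus>\<^bsub>B\<^esub> f y) \<and>
    (\<forall>r\<in>carrier R. \<forall>x\<in>carrier A. f (r \<odot>\<^bsub>A\<^esub> x) = r \<odot>\<^bsub>B\<^esub> f x)}"

definition rmod_hom ::
  "('r, 'k) ring_scheme \<Rightarrow> ('r, 'a) rmodule \<Rightarrow> ('r, 'b) rmodule \<Rightarrow> ('a \<Rightarrow> 'b) set"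
  where "rmod_hom R A B = {f \<in> carrier A \<rightarrow>\<^sub>E carrier B.
    (\<forall>x\<in>carrier A. \<forall>y\<in>carrier A. f (x \<oplus>\<^bsub>A\<^esub> y) = f x \<oplus>\<^bsub>B\<^esub> f y) \<and>
    (\<forall>x\<in>carrier A. \<forall>r\<in>carrier R. f (x \<triangleleft>\<^bsub>A\<^esub> r) = f x \<triangleleft>\<^bsub>B\<^esub> r)}"

definition rmod_iso :: "('r, 'k) ring_scheme \<Rightarrow> ('r, 'a) rmodule \<Rightarrow> ('r, 'b) rmodule \<Rightarrow> bool"
  where "rmod_iso R A B \<longleftrightarrow> (\<exists>f \<in> rmod_hom R A B. bij_betw f (carrier A) (carrier B))"

definition rmod_prod :: "'i set \<Rightarrow> ('i \<Rightarrow> ('r, 'a) rmodule) \<Rightarrow> ('r, 'i \<Rightarrow> 'a) rmodule"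
  where "rmod_prod I N = \<lparr>carrier = (\<Pi>\<^sub>E i\<in>I. carrier (N i)),
    mult = undefined, one = undefined,
    zero = (\<lambda>i\<in>I. \<zero>\<^bsub>N i\<^esub>), add = (\<lambda>x y. \<lambda>i\<in>I. x i \<oplus>\<^bsub>N i\<^esub> y i),
    rsmult = (\<lambda>x r. \<lambda>i\<in>I. x i \<triangleleft>\<^bsub>N i\<^esub> r)\<rparr>"

definition rmod_sum :: "('r, 'a) rmodule \<Rightarrow> ('r, 'b) rmodule \<Rightarrow> ('r, 'a \<times> 'b) rmodule"
  where "rmod_sum A B = \<lparr>carrier = carrier A \<times> carrier B,
    mult = undefined, one = undefined,
    zero = (\<zero>\<^bsub>A\<^esub>, \<zero>\<^bsub>B\<^esub>), add = (\<lambda>x y. (fst x \<oplus>\<^bsub>A\<^esub> fst y, snd x \<oplus>\<^bsub>B\<^esub> snd y)),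
    rsmult = (\<lambda>x r. (fst x \<triangleleft>\<^bsub>A\<^esub> r, snd x \<triangleleft>\<^bsub>B\<^esub> r))\<rparr>"


section \<open>Dualities that apply to a module\<close>

text \<open>
  Endomorphisms of a left module are written on the right: the product of \<open>f\<close> and \<open>g\<close> is
  \<open>f\<close> followed by \<open>g\<close>.
\<close>

definition End_ring :: "('r, 'k) ring_scheme \<Rightarrow> ('r, 'm) module \<Rightarrow> ('m \<Rightarrow> 'm) ring"
  where "End_ring R M = \<lparr>carrier = lmod_hom R M M,
    mult = (\<lambda>f g. compose (carrier M) g f), one = (\<lambda>x\<in>carrier M. x),
    zero = (\<lambda>x\<in>carrier M. \<zero>\<^bsub>M\<^esub>), add = (\<lambda>f g. \<lambda>x\<in>carrier M. f x \<oplus>\<^bsub>M\<^esub> g x)\<rparr>"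

text \<open>The right module \<open>M\<^sub>S\<close> obtained from a ring homomorphism \<open>\<phi>\<close> from \<open>S\<close> to \<open>End_ring R M\<close>.\<close>

definition rmod_of_hom :: "('r, 'm) module \<Rightarrow> ('s \<Rightarrow> 'm \<Rightarrow> 'm) \<Rightarrow> ('s, 'm) rmodule"
  where "rmod_of_hom M \<phi> = \<lparr>carrier = carrier M, mult = undefined, one = undefined,
    zero = \<zero>\<^bsub>M\<^esub>, add = (\<oplus>\<^bsub>M\<^esub>), rsmult = (\<lambda>m s. \<phi> s m)\<rparr>"

text \<open>
  HOL cannot quantify over modules of all types inside a formula, so the test modules range over
  the modules carried by subsets of a universe \<open>'u\<close>.  As soon as \<open>S\<close> embeds into \<open>'u\<close> this
  is not a restriction: the universe then contains copies of all right ideals and of all cyclic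
  modules of \<open>S\<close>, which detect injectivity (Baer) and, for injective modules, cogeneration.
\<close>

definition rmod_injective :: "'u itself \<Rightarrow> ('s, 'k) ring_scheme \<Rightarrow> ('s, 'e) rmodule \<Rightarrow> bool"
  where "rmod_injective U S E \<longleftrightarrow> right_module S E \<and>
    (\<forall>(A :: ('s, 'u) rmodule) (B :: ('s, 'u) rmodule). right_module S A \<longrightarrow> right_module S B \<longrightarrow>
      (\<forall>f \<in> rmod_hom S A B. inj_on f (carrier A) \<longrightarrow>
        (\<forall>g \<in> rmod_hom S A E. \<exists>h \<in> rmod_hom S B E. \<forall>a \<in> carrier A. h (f a) = g a)))"

definition rmod_cogenerator :: "'u itself \<Rightarrow> ('s, 'k) ring_scheme \<Rightarrow> ('s, 'e) rmodule \<Rightarrow> bool"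
  where "rmod_cogenerator U S E \<longleftrightarrow> right_module S E \<and>
    (\<forall>(A :: ('s, 'u) rmodule) (B :: ('s, 'u) rmodule). right_module S A \<longrightarrow> right_module S B \<longrightarrow>
      (\<forall>f \<in> rmod_hom S A B. \<forall>g \<in> rmod_hom S A B. f \<noteq> g \<longrightarrow>
        (\<exists>h \<in> rmod_hom S B E. \<exists>a \<in> carrier A. h (f a) \<noteq> h (g a))))"

definition duality_applies ::
  "'u itself \<Rightarrow> ('r, 'k) ring_scheme \<Rightarrow> ('r, 'm) module \<Rightarrow>
    ('s, 'l) ring_scheme \<Rightarrow> ('s \<Rightarrow> 'm \<Rightarrow> 'm) \<Rightarrow> ('s, 'e) rmodule \<Rightarrow> bool"
  where "duality_applies U R M S \<phi> E \<longleftrightarrow>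
    ring S \<and> \<phi> \<in> ring_hom S (End_ring R M) \<and> rmod_injective U S E \<and> rmod_cogenerator U S E"

text \<open>\<open>Hom\<^sub>S(M\<^sub>S, E)\<close> as a right \<open>R\<close>-module, with \<open>(f r)(m) = f (r m)\<close>.\<close>

definition dual_module ::
  "('r, 'm) module \<Rightarrow> ('s, 'l) ring_scheme \<Rightarrow> ('s \<Rightarrow> 'm \<Rightarrow> 'm) \<Rightarrow> ('s, 'e) rmodule \<Rightarrow>
    ('r, 'm \<Rightarrow> 'e) rmodule"
  where "dual_module M S \<phi> E = \<lparr>carrier = rmod_hom S (rmod_of_hom M \<phi>) E,
    mult = undefined, one = undefined,
    zero = (\<lambda>m\<in>carrier M. \<zero>\<^bsub>E\<^esub>), add = (\<lambda>f g. \<lambda>m\<in>carrier M. f m \<oplus>\<^bsub>E\<^esub> g m),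
    rsmult = (\<lambda>f r. \<lambda>m\<in>carrier M. f (r \<odot>\<^bsub>M\<^esub> m))\<rparr>"


section \<open>The closure under products and direct summands\<close>

text \<open>
  The closure is taken among the right modules carried by subsets of a universe \<open>'u\<close>.  Letting the
  index sets be subsets of \<open>'u\<close> as well is no restriction: discarding zero factors does not change
  a product, and the index set of a product of nonzero modules embeds into that product.
\<close>

inductive_set Prod :: "('r, 'k) ring_scheme \<Rightarrow> ('r, 'u) rmodule set \<Rightarrow> ('r, 'u) rmodule set"
  for R :: "('r, 'k) ring_scheme" and \<X> :: "('r, 'u) rmodule set" where
  base: "N \<in> \<X> \<Longrightarrow> N \<in> Prod R \<X>"
| product: "\<lbrakk>\<And>i. i \<in> I \<Longrightarrow> N i \<in> Prod R \<X>; right_module R P; rmod_iso R (rmod_prod (I :: 'u set) N) P\<rbrakk>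
    \<Longrightarrow> P \<in> Prod R \<X>"
| summand: "\<lbrakk>N \<in> Prod R \<X>; right_module R A; right_module R B;
    rmod_iso R (rmod_sum A (B :: ('r, 'u) rmodule)) N\<rbrakk>
    \<Longrightarrow> A \<in> Prod R \<X>"
| iso: "\<lbrakk>N \<in> Prod R \<X>; right_module R A; rmod_iso R N A\<rbrakk> \<Longrightarrow> A \<in> Prod R \<X>"

text \<open>
  A single module \<open>X\<close> on any type enters \<open>Prod\<close> through its copies in the universe \<open>'u\<close>, which
  exist exactly if the carrier of \<open>X\<close> embeds into \<open>'u\<close>.
\<close>

definition copies :: "('r, 'k) ring_scheme \<Rightarrow> ('r, 'x) rmodule \<Rightarrow> ('r, 'u) rmodule set"
  where "copies R X = {N. right_module R N \<and> rmod_iso R X N}"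

abbreviation Prod_of :: "('r, 'k) ring_scheme \<Rightarrow> ('r, 'x) rmodule \<Rightarrow> ('r, 'u) rmodule set"
  where "Prod_of R X \<equiv> Prod R (copies R X)"

text \<open>
  The power \<open>Y\<^bsup>Hom(X,Y)\<^esup>\<close>: if \<open>X\<close> is isomorphic to a direct summand of any product of copies of
  \<open>Y\<close>, then it is isomorphic to a direct summand of this one.  A universe containing it is thus
  large enough for deciding whether \<open>X\<close> belongs to \<open>Prod(Y)\<close>.
\<close>

definition hom_power ::
  "('r, 'k) ring_scheme \<Rightarrow> ('r, 'x) rmodule \<Rightarrow> ('r, 'y) rmodule \<Rightarrow> ('r, ('x \<Rightarrow> 'y) \<Rightarrow> 'y) rmodule"
  where "hom_power R X Y = rmod_prod (rmod_hom R X Y) (\<lambda>_. Y)"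

end

theory Submission
  imports Defs
begin

text \<open>
  Put \<open>C = End(M)\<close>, \<open>E' = Hom\<^sub>S(C, E)\<close> and \<open>F' = Hom\<^sub>T(C, F)\<close>.  Then \<open>M\<^sup>* = Hom\<^sub>C(M, E')\<close> and
  \<open>M\<^sup>\<sharp> = Hom\<^sub>C(M, F')\<close>, and \<open>E'\<close>, \<open>F'\<close> are injective cogenerators for right \<open>C\<close>-modules.  Hence
  \<open>E'\<close> is a direct summand of a power of \<open>F'\<close>, and applying \<open>Hom\<^sub>C(M, -)\<close> shows that \<open>M\<^sup>*\<close> is a
  direct summand of a power of \<open>M\<^sup>\<sharp>\<close>; the situation is symmetric.
\<close>

section \<open>Right modules and their homomorphisms\<close>

text \<open>The rings \<open>S\<close> and \<open>T\<close> are unrelated; they meet only in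
  \<open>C\<close>, to which both map. This is why coinduction enters: \<open>E'\<close>, built from
  \<open>S\<close>, becomes a \<open>T\<close>-module along \<open>\<psi>\<close>, and then maps
  into \<open>F\<close> can separate its points. These maps index the power of \<open>F'\<close>
  into which \<open>E'\<close> embeds. The splitting needs no \<open>C\<close>-linear map into
  \<open>E'\<close>. A \<open>C\<close>-linear map from a module to \<open>E'\<close> is the same as
  an \<open>S\<close>-linear map to \<open>E\<close>, so an \<open>S\<close>-linear extension of
  evaluation at one, provided by injectivity of \<open>E\<close>, carries all the information. The
  obstacle is the universe. Injectivity and cogeneration are tested on modules in \<open>'u\<close>
  only, but \<open>E'\<close> and the power live on function types. Baer's criterion handles
  extension from right ideals, and separation of points is reduced to cyclic submodules; both kinds
  of test module fit into \<open>'u\<close> as soon as the ring does. The closure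
  \<open>Prod\<close> is also confined to \<open>'u\<close>, so at the end the index set and the
  factors of the power have to be moved there.\<close>

lemma right_moduleI:
  fixes X :: "('r, 'x, 'z) rmodule_scheme" (structure)
  assumes "ring R"
    and "\<And>x y. \<lbrakk>x \<in> carrier X; y \<in> carrier X\<rbrakk> \<Longrightarrow> x \<oplus> y \<in> carrier X"
    and "\<zero> \<in> carrier X"
    and "\<And>x y z. \<lbrakk>x \<in> carrier X; y \<in> carrier X; z \<in> carrier X\<rbrakk> \<Longrightarrow> (x \<oplus> y) \<oplus> z = x \<oplus> (y \<oplus> z)"
    and "\<And>x y. \<lbrakk>x \<in> carrier X; y \<in> carrier X\<rbrakk> \<Longrightarrow> x \<oplus> y = y \<oplus> x"
    and "\<And>x. x \<in> carrier X \<Longrightarrow> \<zero> \<oplus> x = x"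
    and "\<And>x. x \<in> carrier X \<Longrightarrow> \<exists>y\<in>carrier X. y \<oplus> x = \<zero>"
    and "\<And>x r. \<lbrakk>x \<in> carrier X; r \<in> carrier R\<rbrakk> \<Longrightarrow> x \<triangleleft> r \<in> carrier X"
    and "\<And>x y r. \<lbrakk>x \<in> carrier X; y \<in> carrier X; r \<in> carrier R\<rbrakk> \<Longrightarrow> (x \<oplus> y) \<triangleleft> r = x \<triangleleft> r \<oplus> y \<triangleleft> r"
    and "\<And>x r s. \<lbrakk>x \<in> carrier X; r \<in> carrier R; s \<in> carrier R\<rbrakk> \<Longrightarrow>
      x \<triangleleft> (r \<oplus>\<^bsub>R\<^esub> s) = x \<triangleleft> r \<oplus> x \<triangleleft> s"
    and "\<And>x r s. \<lbrakk>x \<in> carrier X; r \<in> carrier R; s \<in> carrier R\<rbrakk> \<Longrightarrow> x \<triangleleft> (r \<otimes>\<^bsub>R\<^esub> s) = (x \<triangleleft> r) \<triangleleft> s"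
    and "\<And>x. x \<in> carrier X \<Longrightarrow> x \<triangleleft> \<one>\<^bsub>R\<^esub> = x"
  shows "right_module R X"
  by (intro right_module.intro right_module_axioms.intro abelian_groupI) (use assms in simp_all)

context right_module
begin

lemma rsmult_zero: "x \<in> carrier M \<Longrightarrow> x \<triangleleft>\<^bsub>M\<^esub> \<zero>\<^bsub>R\<^esub> = \<zero>\<^bsub>M\<^esub>"
  using rsmult_r_distr[of x "\<zero>\<^bsub>R\<^esub>" "\<zero>\<^bsub>R\<^esub>"] rsmult_closed[of x "\<zero>\<^bsub>R\<^esub>"]
  by (metis R.zero_closed R.r_zero M.add.r_cancel_one')

lemma zero_rsmult: "r \<in> carrier R \<Longrightarrow> \<zero>\<^bsub>M\<^esub> \<triangleleft>\<^bsub>M\<^esub> r = \<zero>\<^bsub>M\<^esub>"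
  using rsmult_l_distr[of "\<zero>\<^bsub>M\<^esub>" "\<zero>\<^bsub>M\<^esub>" r] rsmult_closed[of "\<zero>\<^bsub>M\<^esub>" r]
  by (metis M.zero_closed M.r_zero M.add.r_cancel_one')

lemma rsmult_minus_one: "x \<in> carrier M \<Longrightarrow> x \<triangleleft>\<^bsub>M\<^esub> (\<ominus>\<^bsub>R\<^esub> \<one>\<^bsub>R\<^esub>) \<oplus>\<^bsub>M\<^esub> x = \<zero>\<^bsub>M\<^esub>"
  using rsmult_r_distr[of x "\<ominus>\<^bsub>R\<^esub> \<one>\<^bsub>R\<^esub>" "\<one>\<^bsub>R\<^esub>"]
  by (simp add: R.l_neg rsmult_zero rsmult_one)

end

section \<open>Homomorphisms and isomorphisms of right modules\<close>

lemma rmod_hom_closed: "\<lbrakk>f \<in> rmod_hom R A B; x \<in> carrier A\<rbrakk> \<Longrightarrow> f x \<in> carrier B"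
  and rmod_hom_add: "\<lbrakk>f \<in> rmod_hom R A B; x \<in> carrier A; y \<in> carrier A\<rbrakk> \<Longrightarrow> f (x \<oplus>\<^bsub>A\<^esub> y) = f x \<oplus>\<^bsub>B\<^esub> f y"
  and rmod_hom_rsmult: "\<lbrakk>f \<in> rmod_hom R A B; x \<in> carrier A; r \<in> carrier R\<rbrakk> \<Longrightarrow> f (x \<triangleleft>\<^bsub>A\<^esub> r) = f x \<triangleleft>\<^bsub>B\<^esub> r"
  and rmod_hom_extensional: "f \<in> rmod_hom R A B \<Longrightarrow> f \<in> extensional (carrier A)"
  by (auto simp: rmod_hom_def PiE_def)

lemma rmod_hom_eqI:
  "\<lbrakk>f \<in> rmod_hom R A B; g \<in> rmod_hom R A B; \<And>x. x \<in> carrier A \<Longrightarrow> f x = g x\<rbrakk> \<Longrightarrow> f = g"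
  by (meson rmod_hom_extensional extensionalityI)

lemma rmod_hom_zero:
  assumes "right_module R A" "right_module R B" "f \<in> rmod_hom R A B"
  shows "f \<zero>\<^bsub>A\<^esub> = \<zero>\<^bsub>B\<^esub>"
proof -
  interpret A: right_module R A by fact
  interpret B: right_module R B by fact
  have "f \<zero>\<^bsub>A\<^esub> \<oplus>\<^bsub>B\<^esub> f \<zero>\<^bsub>A\<^esub> = f \<zero>\<^bsub>A\<^esub>"
    using rmod_hom_add[OF assms(3), of "\<zero>\<^bsub>A\<^esub>" "\<zero>\<^bsub>A\<^esub>"] by simp
  then show ?thesis using rmod_hom_closed[OF assms(3), of "\<zero>\<^bsub>A\<^esub>"]
    by (metis A.M.zero_closed B.M.add.r_cancel_one')
qed

lemma rmod_hom_restrictI: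
  assumes "right_module R A"
    and "\<And>x. x \<in> carrier A \<Longrightarrow> f x \<in> carrier B"
    and "\<And>x y. \<lbrakk>x \<in> carrier A; y \<in> carrier A\<rbrakk> \<Longrightarrow> f (x \<oplus>\<^bsub>A\<^esub> y) = f x \<oplus>\<^bsub>B\<^esub> f y"
    and "\<And>x r. \<lbrakk>x \<in> carrier A; r \<in> carrier R\<rbrakk> \<Longrightarrow> f (x \<triangleleft>\<^bsub>A\<^esub> r) = f x \<triangleleft>\<^bsub>B\<^esub> r"
  shows "(\<lambda>x\<in>carrier A. f x) \<in> rmod_hom R A B"
proof -
  interpret A: right_module R A by fact
  show ?thesis using assms by (auto simp: rmod_hom_def A.rsmult_closed)
qed

lemma rmod_hom_compose:
  assumes "right_module R A" "f \<in> rmod_hom R A B" "g \<in> rmod_hom R B D"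
  shows "compose (carrier A) g f \<in> rmod_hom R A D"
  unfolding compose_def
  by (rule rmod_hom_restrictI)
    (use assms in \<open>simp_all add: rmod_hom_closed rmod_hom_add rmod_hom_rsmult\<close>)

lemma rmod_hom_inv_into:
  assumes A: "right_module R A" and B: "right_module R B" and f: "f \<in> rmod_hom R A B"
    and bij: "bij_betw f (carrier A) (carrier B)"
  shows "(\<lambda>y\<in>carrier B. inv_into (carrier A) f y) \<in> rmod_hom R B A"
proof (rule rmod_hom_restrictI[OF B])
  let ?g = "inv_into (carrier A) f"
  interpret A: right_module R A by fact
  interpret B: right_module R B by fact
  have g: "?g y \<in> carrier A" "f (?g y) = y" if "y \<in> carrier B" for y
    using that bij by (auto simp: bij_betw_def inv_into_into f_inv_into_f)
  have gf: "?g (f x) = x" if "x \<in> carrier A" for x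
    using that bij by (simp add: bij_betw_def)
  show "?g y \<in> carrier A" if "y \<in> carrier B" for y using g that by blast
  show "?g (x \<oplus>\<^bsub>B\<^esub> y) = ?g x \<oplus>\<^bsub>A\<^esub> ?g y" if "x \<in> carrier B" "y \<in> carrier B" for x y
    using gf[of "?g x \<oplus>\<^bsub>A\<^esub> ?g y"] g that by (simp add: rmod_hom_add[OF f])
  show "?g (x \<triangleleft>\<^bsub>B\<^esub> r) = ?g x \<triangleleft>\<^bsub>A\<^esub> r" if "x \<in> carrier B" "r \<in> carrier R" for x r
    using gf[of "?g x \<triangleleft>\<^bsub>A\<^esub> r"] g that by (simp add: rmod_hom_rsmult[OF f] A.rsmult_closed)
qed

lemma rmod_iso_sym:
  assumes "right_module R A" "right_module R B" "rmod_iso R A B"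
  shows "rmod_iso R B A"
proof -
  obtain f where f: "f \<in> rmod_hom R A B" "bij_betw f (carrier A) (carrier B)"
    using assms(3) by (auto simp: rmod_iso_def)
  have "bij_betw (\<lambda>y\<in>carrier B. inv_into (carrier A) f y) (carrier B) (carrier A)"
    using bij_betw_inv_into[OF f(2)] by (subst bij_betw_cong[of _ _ "inv_into (carrier A) f"]) auto
  then show ?thesis using rmod_hom_inv_into[OF assms(1,2) f] unfolding rmod_iso_def by blast
qed

lemma rmod_iso_trans:
  assumes "right_module R A" "rmod_iso R A B" "rmod_iso R B D"
  shows "rmod_iso R A D"
proof -
  obtain f g where f: "f \<in> rmod_hom R A B" "bij_betw f (carrier A) (carrier B)"
    and g: "g \<in> rmod_hom R B D" "bij_betw g (carrier B) (carrier D)"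
    using assms by (auto simp: rmod_iso_def)
  have "bij_betw (compose (carrier A) g f) (carrier A) (carrier D)"
    using bij_betw_compose f(2) g(2) by blast
  then show ?thesis using rmod_hom_compose[OF assms(1) f(1) g(1)] by (auto simp: rmod_iso_def)
qed

section \<open>Products, direct sums, submodules and transport of structure\<close>

lemma right_module_prod:
  assumes "ring R" "\<And>i. i \<in> I \<Longrightarrow> right_module R (N i)"
  shows "right_module R (rmod_prod I N)"
proof -
  note ag = right_module.axioms(2)[OF assms(2)]
  note am = abelian_group.axioms(1)[OF ag]
  note cl = abelian_monoid.a_closed[OF am] abelian_monoid.zero_closed[OF am] right_module.rsmult_closed[OF assms(2)]
  show ?thesis
  proof (rule right_moduleI[OF assms(1)])
    fix x assume x: "x \<in> carrier (rmod_prod I N)"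
    have "(\<lambda>i\<in>I. \<ominus>\<^bsub>N i\<^esub> x i) \<in> carrier (rmod_prod I N)"
      using x by (auto simp: rmod_prod_def intro!: abelian_group.a_inv_closed[OF ag])
    moreover have "(\<lambda>i\<in>I. \<ominus>\<^bsub>N i\<^esub> x i) \<oplus>\<^bsub>rmod_prod I N\<^esub> x = \<zero>\<^bsub>rmod_prod I N\<^esub>"
      using x by (auto simp: rmod_prod_def fun_eq_iff abelian_group.l_neg[OF ag] dest!: PiE_mem)
    ultimately show "\<exists>y\<in>carrier (rmod_prod I N). y \<oplus>\<^bsub>rmod_prod I N\<^esub> x = \<zero>\<^bsub>rmod_prod I N\<^esub>" by blast
  next
    fix x y assume "x \<in> carrier (rmod_prod I N)" "y \<in> carrier (rmod_prod I N)"
    then show "x \<oplus>\<^bsub>rmod_prod I N\<^esub> y = y \<oplus>\<^bsub>rmod_prod I N\<^esub> x"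
      by (auto simp: rmod_prod_def fun_eq_iff PiE_mem intro: abelian_monoid.a_comm[OF am])
  next
    fix x assume "x \<in> carrier (rmod_prod I N)"
    then have x: "\<And>i. i \<in> I \<Longrightarrow> x i \<in> carrier (N i)" and ext: "x \<in> extensional I"
      by (auto simp: rmod_prod_def PiE_def)
    show "\<zero>\<^bsub>rmod_prod I N\<^esub> \<oplus>\<^bsub>rmod_prod I N\<^esub> x = x"
      by (rule extensionalityI[OF _ ext]) (simp_all add: rmod_prod_def x abelian_monoid.l_zero[OF am])
    show "x \<triangleleft>\<^bsub>rmod_prod I N\<^esub> \<one>\<^bsub>R\<^esub> = x"
      by (rule extensionalityI[OF _ ext]) (simp_all add: rmod_prod_def x right_module.rsmult_one[OF assms(2)])
  qed (auto simp: rmod_prod_def cl abelian_monoid.a_assoc[OF am]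
      right_module.rsmult_l_distr[OF assms(2)] right_module.rsmult_r_distr[OF assms(2)]
      right_module.rsmult_assoc[OF assms(2)] intro!: restrict_ext dest!: PiE_mem)
qed

lemma right_module_sum:
  assumes "right_module R A" "right_module R B"
  shows "right_module R (rmod_sum A B)"
proof -
  interpret A: right_module R A by fact
  interpret B: right_module R B by fact
  show ?thesis
  proof (rule right_moduleI)
    fix x assume "x \<in> carrier (rmod_sum A B)"
    then show "\<exists>y\<in>carrier (rmod_sum A B). y \<oplus>\<^bsub>rmod_sum A B\<^esub> x = \<zero>\<^bsub>rmod_sum A B\<^esub>"
      by (intro bexI[of _ "(\<ominus>\<^bsub>A\<^esub> fst x, \<ominus>\<^bsub>B\<^esub> snd x)"])
        (auto simp: rmod_sum_def A.M.l_neg B.M.l_neg)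
  qed (auto simp: rmod_sum_def A.M.a_assoc B.M.a_assoc A.rsmult_closed
      B.rsmult_closed A.rsmult_l_distr B.rsmult_l_distr A.rsmult_r_distr B.rsmult_r_distr
      A.rsmult_assoc B.rsmult_assoc A.rsmult_one B.rsmult_one A.R.ring_axioms
      intro: A.M.a_comm B.M.a_comm)
qed

text \<open>Closure under negation comes from the action of minus one
  (\<open>rsmult_minus_one\<close>), so the closure conditions do not list it. This shortens the
  later checks, above all those for graphs.\<close>

definition rsubmodule :: "('r, 'k) ring_scheme \<Rightarrow> ('r, 'x) rmodule \<Rightarrow> 'x set \<Rightarrow> bool"
  where "rsubmodule R X D \<longleftrightarrow> D \<subseteq> carrier X \<and> \<zero>\<^bsub>X\<^esub> \<in> D \<and>
    (\<forall>x\<in>D. \<forall>y\<in>D. x \<oplus>\<^bsub>X\<^esub> y \<in> D) \<and> (\<forall>x\<in>D. \<forall>r\<in>carrier R. x \<triangleleft>\<^bsub>X\<^esub> r \<in> D)"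

lemma right_module_rsubmodule:
  assumes "right_module R X" "rsubmodule R X D"
  shows "right_module R (X\<lparr>carrier := D\<rparr>)"
proof -
  interpret X: right_module R X by fact
  have D: "\<And>x. x \<in> D \<Longrightarrow> x \<in> carrier X" "\<zero>\<^bsub>X\<^esub> \<in> D" "\<And>x y. x \<in> D \<Longrightarrow> y \<in> D \<Longrightarrow> x \<oplus>\<^bsub>X\<^esub> y \<in> D"
    "\<And>x r. x \<in> D \<Longrightarrow> r \<in> carrier R \<Longrightarrow> x \<triangleleft>\<^bsub>X\<^esub> r \<in> D"
    using assms(2) by (auto simp: rsubmodule_def)
  show ?thesis
  proof (rule right_moduleI)
    fix x assume "x \<in> carrier (X\<lparr>carrier := D\<rparr>)"
    then show "\<exists>y\<in>carrier (X\<lparr>carrier := D\<rparr>). y \<oplus>\<^bsub>X\<lparr>carrier := D\<rparr>\<^esub> x = \<zero>\<^bsub>X\<lparr>carrier := D\<rparr>\<^esub>"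
      by (intro bexI[of _ "x \<triangleleft>\<^bsub>X\<^esub> (\<ominus>\<^bsub>R\<^esub> \<one>\<^bsub>R\<^esub>)"]) (auto simp: D X.rsmult_minus_one)
  qed (auto simp: D X.M.a_assoc X.rsmult_l_distr X.rsmult_r_distr X.rsmult_assoc
      X.rsmult_one X.R.ring_axioms
      intro: X.M.a_comm)
qed

lemma rmod_hom_inclusion:
  assumes "right_module R X" "rsubmodule R X D"
  shows "(\<lambda>x\<in>D. x) \<in> rmod_hom R (X\<lparr>carrier := D\<rparr>) X"
  using rmod_hom_restrictI[OF right_module_rsubmodule[OF assms], of "\<lambda>x. x" X] assms(2)
  by (auto simp: rsubmodule_def)

text \<open>The backward map \<open>i'\<close> is an argument of its own and has to invert
  \<open>i\<close> only on the carrier in question. A submodule and its ambient module can therefore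
  be moved by the same pair of maps. The purpose is to bring modules into \<open>'u\<close>, where
  injectivity and cogeneration can be tested.\<close>

definition rmod_transport :: "('x \<Rightarrow> 'y) \<Rightarrow> ('y \<Rightarrow> 'x) \<Rightarrow> ('r, 'x) rmodule \<Rightarrow> ('r, 'y) rmodule"
  where "rmod_transport i i' X = \<lparr>carrier = i ` carrier X, mult = undefined, one = undefined,
    zero = i \<zero>\<^bsub>X\<^esub>, add = (\<lambda>x y. i (i' x \<oplus>\<^bsub>X\<^esub> i' y)), rsmult = (\<lambda>x r. i (i' x \<triangleleft>\<^bsub>X\<^esub> r))\<rparr>"

lemma right_module_transport:
  assumes "right_module R X" "\<And>x. x \<in> carrier X \<Longrightarrow> i' (i x) = x"
  shows "right_module R (rmod_transport i i' X)"
proof -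
  interpret X: right_module R X by fact
  show ?thesis
  proof (rule right_moduleI)
    fix x assume "x \<in> carrier (rmod_transport i i' X)"
    then show "\<exists>y\<in>carrier (rmod_transport i i' X). y \<oplus>\<^bsub>rmod_transport i i' X\<^esub> x = \<zero>\<^bsub>rmod_transport i i' X\<^esub>"
      by (intro bexI[of _ "i (\<ominus>\<^bsub>X\<^esub> i' x)"]) (auto simp: rmod_transport_def assms(2) X.M.l_neg)
  qed (auto simp: rmod_transport_def assms(2) X.M.a_assoc X.rsmult_l_distr X.rsmult_r_distr
      X.rsmult_assoc X.rsmult_one X.rsmult_closed X.R.ring_axioms
      intro!: arg_cong[of _ _ i] intro: X.M.a_comm)
qed

lemma rmod_hom_transport:
  assumes "right_module R X" "\<And>x. x \<in> carrier X \<Longrightarrow> i' (i x) = x"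
  shows "(\<lambda>x\<in>carrier X. i x) \<in> rmod_hom R X (rmod_transport i i' X)"
    and "(\<lambda>y\<in>carrier (rmod_transport i i' X). i' y) \<in> rmod_hom R (rmod_transport i i' X) X"
    and "rmod_iso R X (rmod_transport i i' X)"
proof -
  interpret X: right_module R X by fact
  show i: "(\<lambda>x\<in>carrier X. i x) \<in> rmod_hom R X (rmod_transport i i' X)"
    by (rule rmod_hom_restrictI[OF assms(1)]) (auto simp: rmod_transport_def assms(2))
  show "(\<lambda>y\<in>carrier (rmod_transport i i' X). i' y) \<in> rmod_hom R (rmod_transport i i' X) X"
    by (rule rmod_hom_restrictI[OF right_module_transport[of R X i' i, OF assms]])
      (auto simp: rmod_transport_def assms(2) X.rsmult_closed)
  have "inj_on i (carrier X)" by (metis assms(2) inj_on_inverseI)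
  then have "bij_betw (\<lambda>x\<in>carrier X. i x) (carrier X) (carrier (rmod_transport i i' X))"
    by (auto simp: bij_betw_def rmod_transport_def inj_on_def)
  with i show "rmod_iso R X (rmod_transport i i' X)" unfolding rmod_iso_def by blast
qed

lemma copies_nonempty:
  assumes "right_module R X" "carrier X \<lesssim> (UNIV :: 'u set)"
  obtains N :: "('r, 'u) rmodule" where "N \<in> copies R (X :: ('r, 'x) rmodule)"
proof -
  obtain i :: "'x \<Rightarrow> 'u" where "inj_on i (carrier X)" using assms(2) by (auto simp: lepoll_def)
  then have "\<And>x. x \<in> carrier X \<Longrightarrow> inv_into (carrier X) i (i x) = x" by simp
  then show ?thesis
    using that right_module_transport[OF assms(1), of "inv_into (carrier X) i" i]
      rmod_hom_transport(3)[OF assms(1), of "inv_into (carrier X) i" i]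
    by (simp add: copies_def)
qed

section \<open>Injective cogenerators and modules outside the universe\<close>

text \<open>Its instances of \<open>rsubmodule\<close> are the right ideals of \<open>S\<close>, the
  test objects of Baer's criterion.\<close>

definition regular_rmodule :: "('s, 'k) ring_scheme \<Rightarrow> ('s, 's) rmodule"
  where "regular_rmodule S = \<lparr>carrier = carrier S, mult = undefined, one = undefined,
    zero = \<zero>\<^bsub>S\<^esub>, add = (\<oplus>\<^bsub>S\<^esub>), rsmult = (\<otimes>\<^bsub>S\<^esub>)\<rparr>"

lemma right_module_regular:
  assumes "ring S"
  shows "right_module S (regular_rmodule S)"
proof -
  interpret S: ring S by fact
  show ?thesis
    by (rule right_moduleI)
      (auto simp: regular_rmodule_def S.a_assoc S.a_comm S.a_lcomm S.l_distr S.r_distr S.m_assoc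
        intro: S.ring_axioms bexI[of _ "\<ominus>\<^bsub>S\<^esub> _"] S.l_neg)
qed

text \<open>A map on a right ideal extends to all of \<open>S\<close>, and a map out of
  \<open>S\<close> is determined by its value at one; that value is \<open>e\<close>. This is the
  only place where the extension property in \<open>rmod_injective\<close> is applied directly, so
  an embedding of \<open>carrier S\<close> into \<open>'u\<close> is all that later extensions
  require of the universe.\<close>

lemma injective_right_ideal:
  fixes S :: "('s, 'k) ring_scheme" and E :: "('s, 'e) rmodule"
  assumes S: "ring S" "carrier S \<lesssim> (UNIV :: 'u set)" and E: "rmod_injective TYPE('u) S E"
    and D: "rsubmodule S (regular_rmodule S) D"
    and k: "k \<in> rmod_hom S ((regular_rmodule S)\<lparr>carrier := D\<rparr>) E"
  obtains e where "e \<in> carrier E" "\<And>s. s \<in> D \<Longrightarrow> k s = e \<triangleleft>\<^bsub>E\<^esub> s"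
proof -
  interpret S: ring S by fact
  let ?S = "regular_rmodule S" and ?D = "(regular_rmodule S)\<lparr>carrier := D\<rparr>"
  have DS: "D \<subseteq> carrier S" using D by (auto simp: rsubmodule_def regular_rmodule_def)
  obtain i :: "'s \<Rightarrow> 'u" where i: "inj_on i (carrier S)" using S(2) by (auto simp: lepoll_def)
  define i' where "i' = inv_into (carrier S) i"
  have i': "i' (i x) = x" if "x \<in> carrier S" for x using i that by (simp add: i'_def)
  \<comment> \<open>Ideal and ring are moved by the same \<open>i\<close> and \<open>i'\<close>, so
    the inclusion of \<open>D\<close> becomes the literal inclusion of one carrier in the
    other.\<close>
  define A where "A = rmod_transport i i' ?D"
  define B where "B = rmod_transport i i' ?S"
  have mods: "right_module S ?S" "right_module S ?D"
    using right_module_regular[OF S(1)] right_module_rsubmodule D by auto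
  have i'S: "\<And>x. x \<in> carrier ?S \<Longrightarrow> i' (i x) = x" and i'D: "\<And>x. x \<in> carrier ?D \<Longrightarrow> i' (i x) = x"
    using i' DS by (auto simp: regular_rmodule_def)
  have A: "right_module S A" unfolding A_def by (rule right_module_transport[of S ?D i' i, OF mods(2) i'D])
  have B: "right_module S B" unfolding B_def by (rule right_module_transport[of S ?S i' i, OF mods(1) i'S])
  have f: "(\<lambda>x\<in>carrier A. x) \<in> rmod_hom S A B"
    by (rule rmod_hom_restrictI[OF A]) (use DS in \<open>auto simp: A_def B_def rmod_transport_def regular_rmodule_def\<close>)
  have "(\<lambda>y\<in>carrier A. i' y) \<in> rmod_hom S A ?D"
    unfolding A_def by (rule rmod_hom_transport(2)[of S ?D i' i, OF mods(2) i'D])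
  from rmod_hom_compose[OF A this k] have g: "compose (carrier A) k (\<lambda>y\<in>carrier A. i' y) \<in> rmod_hom S A E" .
  have "inj_on (\<lambda>x\<in>carrier A. x) (carrier A)" by (simp add: inj_on_def)
  then obtain h where h: "h \<in> rmod_hom S B E" "\<And>a. a \<in> carrier A \<Longrightarrow> h ((\<lambda>x\<in>carrier A. x) a) =
      compose (carrier A) k (\<lambda>y\<in>carrier A. i' y) a"
    using E[unfolded rmod_injective_def, THEN conjunct2, rule_format, OF A B f _ g] by blast
  show ?thesis
  proof
    have one: "i \<one>\<^bsub>S\<^esub> \<in> carrier B" by (auto simp: B_def rmod_transport_def regular_rmodule_def)
    then show "h (i \<one>\<^bsub>S\<^esub>) \<in> carrier E" by (rule rmod_hom_closed[OF h(1)])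
    fix s assume s: "s \<in> D"
    then have sS: "s \<in> carrier S" and sA: "i s \<in> carrier A"
      using DS by (auto simp: A_def rmod_transport_def)
    have "k s = h (i s)" using h(2)[OF sA] sA i'[OF sS] by (simp add: compose_def)
    also have "i s = i \<one>\<^bsub>S\<^esub> \<triangleleft>\<^bsub>B\<^esub> s" using sS by (simp add: B_def rmod_transport_def regular_rmodule_def i')
    also have "h \<dots> = h (i \<one>\<^bsub>S\<^esub>) \<triangleleft>\<^bsub>E\<^esub> s" by (rule rmod_hom_rsmult[OF h(1) one sS])
    finally show "k s = h (i \<one>\<^bsub>S\<^esub>) \<triangleleft>\<^bsub>E\<^esub> s" .
  qed
qed

text \<open>
  Baer's criterion.  Partial extensions are represented by their graphs, which are submodules of
  \<open>B \<oplus> E\<close>; being single-valued then reduces to a condition on the fibre over \<open>\<zero>\<close>.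
\<close>

lemma injective_extend:
  fixes S :: "('s, 'k) ring_scheme" and E :: "('s, 'e) rmodule"
    and A :: "('s, 'a) rmodule" and B :: "('s, 'b) rmodule"
  assumes S: "ring S" "carrier S \<lesssim> (UNIV :: 'u set)" and E: "rmod_injective TYPE('u) S E"
    and A: "right_module S A" and B: "right_module S B"
    and f: "f \<in> rmod_hom S A B" "inj_on f (carrier A)" and g: "g \<in> rmod_hom S A E"
  obtains h where "h \<in> rmod_hom S B E" "\<And>a. a \<in> carrier A \<Longrightarrow> h (f a) = g a"
proof -
  have ER: "right_module S E" using E by (simp add: rmod_injective_def)
  interpret S: ring S by fact
  interpret A: right_module S A by fact
  interpret B: right_module S B by fact
  interpret E: right_module S E by fact
  define \<G> where "\<G> = {G. rsubmodule S (rmod_sum B E) G \<and> (\<forall>e. (\<zero>\<^bsub>B\<^esub>, e) \<in> G \<longrightarrow> e = \<zero>\<^bsub>E\<^esub>) \<and>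
    (\<lambda>a. (f a, g a)) ` carrier A \<subseteq> G}"
  note fg0 = rmod_hom_zero[OF A B f(1)] rmod_hom_zero[OF A ER g]
  have "(\<lambda>a. (f a, g a)) ` carrier A \<in> \<G>"
  proof -
    have "rsubmodule S (rmod_sum B E) ((\<lambda>a. (f a, g a)) ` carrier A)"
      unfolding rsubmodule_def
    proof (intro conjI ballI)
      show "\<zero>\<^bsub>rmod_sum B E\<^esub> \<in> (\<lambda>a. (f a, g a)) ` carrier A"
        by (rule image_eqI[of _ _ "\<zero>\<^bsub>A\<^esub>"]) (simp_all add: rmod_sum_def fg0)
    qed (auto simp: rmod_sum_def A.rsmult_closed rmod_hom_closed[OF f(1)] rmod_hom_closed[OF g]
        rmod_hom_add[OF f(1), symmetric] rmod_hom_add[OF g, symmetric]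
        rmod_hom_rsmult[OF f(1), symmetric] rmod_hom_rsmult[OF g, symmetric])
    \<comment> \<open>Injectivity of \<open>f\<close> enters here: the pairs
      \<open>(f a, g a)\<close> have a trivial fibre over zero, so the set to be enlarged is itself
      the graph of a partial map.\<close>
    moreover have "g a = \<zero>\<^bsub>E\<^esub>" if "a \<in> carrier A" "f a = \<zero>\<^bsub>B\<^esub>" for a
      using that f(2) fg0 by (metis A.M.zero_closed inj_onD)
    ultimately show ?thesis by (auto simp: \<G>_def)
  qed
  then have ne: "\<G> \<noteq> {}" by blast
  have chain: "\<Union>\<C> \<in> \<G>" if Cne: "\<C> \<noteq> {}" and "subset.chain \<G> \<C>" for \<C>
  proof -
    have mem: "\<And>G. G \<in> \<C> \<Longrightarrow> G \<in> \<G>"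
      and lin: "\<And>G H. G \<in> \<C> \<Longrightarrow> H \<in> \<C> \<Longrightarrow> G \<subseteq> H \<or> H \<subseteq> G"
      using that(2) by (auto simp: subset.chain_def)
    have sub: "rsubmodule S (rmod_sum B E) G" if "G \<in> \<C>" for G using mem[OF that] by (simp add: \<G>_def)
    have "x \<oplus>\<^bsub>rmod_sum B E\<^esub> y \<in> \<Union>\<C>" if xy: "x \<in> \<Union>\<C>" "y \<in> \<Union>\<C>" for x y
    proof -
      obtain G where "G \<in> \<C>" "x \<in> G" "y \<in> G" using xy lin by blast
      then show ?thesis using sub[of G] unfolding rsubmodule_def by blast
    qed
    moreover have "x \<triangleleft>\<^bsub>rmod_sum B E\<^esub> r \<in> \<Union>\<C>" if "x \<in> \<Union>\<C>" "r \<in> carrier S" for x r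
      using that sub unfolding rsubmodule_def by blast
    moreover have "\<Union>\<C> \<subseteq> carrier (rmod_sum B E)" "\<forall>e. (\<zero>\<^bsub>B\<^esub>, e) \<in> \<Union>\<C> \<longrightarrow> e = \<zero>\<^bsub>E\<^esub>"
      using mem unfolding \<G>_def rsubmodule_def by blast+
    moreover obtain G where "G \<in> \<C>" using Cne by blast
    then have "\<zero>\<^bsub>rmod_sum B E\<^esub> \<in> \<Union>\<C>" "(\<lambda>a. (f a, g a)) ` carrier A \<subseteq> \<Union>\<C>"
      using mem[of G] unfolding \<G>_def rsubmodule_def by blast+
    ultimately show ?thesis unfolding \<G>_def rsubmodule_def by blast
  qed
  obtain G where G: "G \<in> \<G>" and max: "\<And>H. H \<in> \<G> \<Longrightarrow> G \<subseteq> H \<Longrightarrow> H = G"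
    using subset_Zorn_nonempty[OF ne chain] by metis
  have sub: "rsubmodule S (rmod_sum B E) G" and Gz: "\<And>e. (\<zero>\<^bsub>B\<^esub>, e) \<in> G \<Longrightarrow> e = \<zero>\<^bsub>E\<^esub>"
    and Gfg: "\<And>a. a \<in> carrier A \<Longrightarrow> (f a, g a) \<in> G"
    using G unfolding \<G>_def by blast+
  have GC: "b \<in> carrier B" "e \<in> carrier E" if "(b, e) \<in> G" for b e
    using sub that by (auto simp: rsubmodule_def rmod_sum_def)
  have G0: "(\<zero>\<^bsub>B\<^esub>, \<zero>\<^bsub>E\<^esub>) \<in> G"
    and Gadd': "\<And>x y. x \<in> G \<Longrightarrow> y \<in> G \<Longrightarrow> (fst x \<oplus>\<^bsub>B\<^esub> fst y, snd x \<oplus>\<^bsub>E\<^esub> snd y) \<in> G"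
    and Gsm': "\<And>x r. x \<in> G \<Longrightarrow> r \<in> carrier S \<Longrightarrow> (fst x \<triangleleft>\<^bsub>B\<^esub> r, snd x \<triangleleft>\<^bsub>E\<^esub> r) \<in> G"
    using sub by (simp_all add: rsubmodule_def rmod_sum_def)
  have Gadd: "(b \<oplus>\<^bsub>B\<^esub> b', e \<oplus>\<^bsub>E\<^esub> e') \<in> G" if "(b, e) \<in> G" "(b', e') \<in> G" for b b' e e'
    using Gadd'[OF that] by simp
  have Gsm: "(b \<triangleleft>\<^bsub>B\<^esub> r, e \<triangleleft>\<^bsub>E\<^esub> r) \<in> G" if "(b, e) \<in> G" "r \<in> carrier S" for b e r
    using Gsm'[OF that] by simp
  have single: "e = e'" if "(b, e) \<in> G" "(b, e') \<in> G" for b e e'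
  proof -
    let ?m = "\<ominus>\<^bsub>S\<^esub> \<one>\<^bsub>S\<^esub>"
    have m: "?m \<in> carrier S" by simp
    have "(b \<triangleleft>\<^bsub>B\<^esub> ?m \<oplus>\<^bsub>B\<^esub> b, e \<triangleleft>\<^bsub>E\<^esub> ?m \<oplus>\<^bsub>E\<^esub> e') \<in> G" using Gadd[OF Gsm[OF that(1) m] that(2)] .
    then have "e \<triangleleft>\<^bsub>E\<^esub> ?m \<oplus>\<^bsub>E\<^esub> e' = \<zero>\<^bsub>E\<^esub>" using Gz B.rsmult_minus_one GC that by simp
    moreover have "e \<triangleleft>\<^bsub>E\<^esub> ?m \<oplus>\<^bsub>E\<^esub> e = \<zero>\<^bsub>E\<^esub>" using E.rsmult_minus_one GC that by simp
    moreover have "e \<triangleleft>\<^bsub>E\<^esub> ?m \<in> carrier E" using GC that m E.rsmult_closed by simp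
    ultimately show ?thesis
      using GC that E.M.a_comm[of "e \<triangleleft>\<^bsub>E\<^esub> ?m"] E.M.add.right_cancel[of "e \<triangleleft>\<^bsub>E\<^esub> ?m" e e'] by simp
  qed
  have total: "\<exists>e. (b, e) \<in> G" if b: "b \<in> carrier B" for b
  proof -
    \<comment> \<open>\<open>D\<close> consists of the scalars that carry \<open>b\<close> into the
      domain of \<open>G\<close>, and \<open>k\<close> records the values that \<open>G\<close>
      already prescribes on those multiples of \<open>b\<close>. The case of right ideals turns
      \<open>k\<close> into a candidate value \<open>e0\<close> for \<open>b\<close> that agrees
      with all of them.\<close>
    define D where "D = {s \<in> carrier S. \<exists>e. (b \<triangleleft>\<^bsub>B\<^esub> s, e) \<in> G}"
    define k where "k = (\<lambda>s\<in>D. THE e. (b \<triangleleft>\<^bsub>B\<^esub> s, e) \<in> G)"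
    have k: "(b \<triangleleft>\<^bsub>B\<^esub> s, k s) \<in> G" if "s \<in> D" for s
    proof -
      have "\<exists>!e. (b \<triangleleft>\<^bsub>B\<^esub> s, e) \<in> G" using that single by (auto simp: D_def)
      from theI'[OF this] show ?thesis using that by (simp add: k_def)
    qed
    have D: "rsubmodule S (regular_rmodule S) D"
      unfolding rsubmodule_def
    proof (intro conjI ballI)
      show "\<zero>\<^bsub>regular_rmodule S\<^esub> \<in> D"
        using G0 b by (auto simp: D_def regular_rmodule_def B.rsmult_zero)
      show "x \<oplus>\<^bsub>regular_rmodule S\<^esub> y \<in> D" if "x \<in> D" "y \<in> D" for x y
        using Gadd[OF k k, OF that] that b by (auto simp: D_def regular_rmodule_def B.rsmult_r_distr)
      show "x \<triangleleft>\<^bsub>regular_rmodule S\<^esub> r \<in> D" if "x \<in> D" "r \<in> carrier S" for x r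
        using Gsm[OF k, OF that] that b by (auto simp: D_def regular_rmodule_def B.rsmult_assoc)
    qed (auto simp: D_def regular_rmodule_def)
    have khom: "k \<in> rmod_hom S ((regular_rmodule S)\<lparr>carrier := D\<rparr>) E"
    proof -
      have "(\<lambda>s\<in>carrier ((regular_rmodule S)\<lparr>carrier := D\<rparr>). k s) \<in> rmod_hom S ((regular_rmodule S)\<lparr>carrier := D\<rparr>) E"
      proof (rule rmod_hom_restrictI[OF right_module_rsubmodule[OF right_module_regular[OF S(1)] D]], simp_all)
        show "k x \<in> carrier E" if "x \<in> D" for x using GC k that by blast
        show "k (x \<oplus>\<^bsub>regular_rmodule S\<^esub> y) = k x \<oplus>\<^bsub>E\<^esub> k y" if "x \<in> D" "y \<in> D" for x y
        proof (rule single)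
          show "(b \<triangleleft>\<^bsub>B\<^esub> (x \<oplus>\<^bsub>regular_rmodule S\<^esub> y), k (x \<oplus>\<^bsub>regular_rmodule S\<^esub> y)) \<in> G"
            using D that by (intro k) (auto simp: rsubmodule_def)
          show "(b \<triangleleft>\<^bsub>B\<^esub> (x \<oplus>\<^bsub>regular_rmodule S\<^esub> y), k x \<oplus>\<^bsub>E\<^esub> k y) \<in> G"
            using Gadd[OF k k, OF that] that b by (auto simp: D_def regular_rmodule_def B.rsmult_r_distr)
        qed
        show "k (x \<triangleleft>\<^bsub>regular_rmodule S\<^esub> r) = k x \<triangleleft>\<^bsub>E\<^esub> r" if "x \<in> D" "r \<in> carrier S" for x r
        proof (rule single)
          show "(b \<triangleleft>\<^bsub>B\<^esub> (x \<triangleleft>\<^bsub>regular_rmodule S\<^esub> r), k (x \<triangleleft>\<^bsub>regular_rmodule S\<^esub> r)) \<in> G"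
            using D that by (intro k) (auto simp: rsubmodule_def)
          show "(b \<triangleleft>\<^bsub>B\<^esub> (x \<triangleleft>\<^bsub>regular_rmodule S\<^esub> r), k x \<triangleleft>\<^bsub>E\<^esub> r) \<in> G"
            using Gsm[OF k, OF that] that b by (auto simp: D_def regular_rmodule_def B.rsmult_assoc)
        qed
      qed
      moreover have "restrict k D = k" by (auto simp: k_def)
      ultimately show ?thesis by simp
    qed
    obtain e0 where e0: "e0 \<in> carrier E" "\<And>s. s \<in> D \<Longrightarrow> k s = e0 \<triangleleft>\<^bsub>E\<^esub> s"
      using injective_right_ideal[OF S E D khom] by blast
    \<comment> \<open>The cyclic submodule generated by \<open>(b, e0)\<close> is added to
      \<open>G\<close>. Once \<open>G'\<close> is known to lie in \<open>\<G>\<close>, maximality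
      gives \<open>G' = G\<close>, so \<open>b\<close> was in the domain from the start.\<close>
    define G' where "G' = {(x \<oplus>\<^bsub>B\<^esub> b \<triangleleft>\<^bsub>B\<^esub> s, y \<oplus>\<^bsub>E\<^esub> e0 \<triangleleft>\<^bsub>E\<^esub> s) |x y s. (x, y) \<in> G \<and> s \<in> carrier S}"
    have "G \<subseteq> G'"
    proof (clarify)
      fix x y assume xy: "(x, y) \<in> G"
      then have "(x, y) = (x \<oplus>\<^bsub>B\<^esub> b \<triangleleft>\<^bsub>B\<^esub> \<zero>\<^bsub>S\<^esub>, y \<oplus>\<^bsub>E\<^esub> e0 \<triangleleft>\<^bsub>E\<^esub> \<zero>\<^bsub>S\<^esub>)"
        using b e0 GC by (simp add: B.rsmult_zero E.rsmult_zero)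
      then show "(x, y) \<in> G'" using xy unfolding G'_def by blast
    qed
    moreover have "(b, e0) \<in> G'"
    proof -
      have "(b, e0) = (\<zero>\<^bsub>B\<^esub> \<oplus>\<^bsub>B\<^esub> b \<triangleleft>\<^bsub>B\<^esub> \<one>\<^bsub>S\<^esub>, \<zero>\<^bsub>E\<^esub> \<oplus>\<^bsub>E\<^esub> e0 \<triangleleft>\<^bsub>E\<^esub> \<one>\<^bsub>S\<^esub>)"
        using b e0 by (simp add: B.rsmult_one E.rsmult_one)
      then show ?thesis using G0 unfolding G'_def by blast
    qed
    moreover have "G' \<in> \<G>"
    proof -
      have "e = \<zero>\<^bsub>E\<^esub>" if "(\<zero>\<^bsub>B\<^esub>, e) \<in> G'" for e
      proof -
        obtain x y s where xy: "(x, y) \<in> G" "s \<in> carrier S" "\<zero>\<^bsub>B\<^esub> = x \<oplus>\<^bsub>B\<^esub> b \<triangleleft>\<^bsub>B\<^esub> s" "e = y \<oplus>\<^bsub>E\<^esub> e0 \<triangleleft>\<^bsub>E\<^esub> s"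
          using \<open>(\<zero>\<^bsub>B\<^esub>, e) \<in> G'\<close> by (auto simp: G'_def)
        let ?m = "\<ominus>\<^bsub>S\<^esub> \<one>\<^bsub>S\<^esub>"
        \<comment> \<open>The multiple of \<open>b\<close> by \<open>s\<close> equals minus
          \<open>x\<close> and hence lies in the domain of \<open>G\<close>, so \<open>s\<close> is
          in \<open>D\<close>. The value of \<open>G\<close> there is minus \<open>y\<close>, and by
          the choice of \<open>e0\<close> it is also \<open>e0\<close> times \<open>s\<close>; the
          two terms of \<open>e\<close> cancel.\<close>
        have "b \<triangleleft>\<^bsub>B\<^esub> s = x \<triangleleft>\<^bsub>B\<^esub> ?m"
          using xy(1-3) b GC[OF xy(1)] B.rsmult_minus_one[of x]
            B.M.a_comm[of x "b \<triangleleft>\<^bsub>B\<^esub> s"] B.rsmult_closed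
            B.M.add.right_cancel[of x "b \<triangleleft>\<^bsub>B\<^esub> s" "x \<triangleleft>\<^bsub>B\<^esub> ?m"] by simp
        then have bs: "(b \<triangleleft>\<^bsub>B\<^esub> s, y \<triangleleft>\<^bsub>E\<^esub> ?m) \<in> G" using Gsm[OF xy(1), of ?m] by simp
        then have "s \<in> D" using xy(2) by (auto simp: D_def)
        then have "y \<triangleleft>\<^bsub>E\<^esub> ?m = e0 \<triangleleft>\<^bsub>E\<^esub> s" using single[OF bs k] e0(2) by simp
        then show ?thesis
          using xy E.rsmult_minus_one[of y] GC[OF xy(1)] e0(1)
            E.M.a_comm[of y "e0 \<triangleleft>\<^bsub>E\<^esub> s"] E.rsmult_closed[of e0 s] by simp
      qed
      moreover have "rsubmodule S (rmod_sum B E) G'"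
        unfolding rsubmodule_def
      proof (intro conjI ballI)
        show "G' \<subseteq> carrier (rmod_sum B E)"
          using b e0 GC by (auto simp: G'_def rmod_sum_def B.rsmult_closed E.rsmult_closed)
        show "\<zero>\<^bsub>rmod_sum B E\<^esub> \<in> G'" using G0 \<open>G \<subseteq> G'\<close> by (auto simp: rmod_sum_def)
        show "p \<oplus>\<^bsub>rmod_sum B E\<^esub> q \<in> G'" if pG: "p \<in> G'" and qG: "q \<in> G'" for p q
        proof -
          obtain x y s where p: "(x, y) \<in> G" "s \<in> carrier S" "p = (x \<oplus>\<^bsub>B\<^esub> b \<triangleleft>\<^bsub>B\<^esub> s, y \<oplus>\<^bsub>E\<^esub> e0 \<triangleleft>\<^bsub>E\<^esub> s)"
            using pG by (auto simp: G'_def)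
          obtain x' y' s' where q: "(x', y') \<in> G" "s' \<in> carrier S" "q = (x' \<oplus>\<^bsub>B\<^esub> b \<triangleleft>\<^bsub>B\<^esub> s', y' \<oplus>\<^bsub>E\<^esub> e0 \<triangleleft>\<^bsub>E\<^esub> s')"
            using qG by (auto simp: G'_def)
          have "p \<oplus>\<^bsub>rmod_sum B E\<^esub> q = ((x \<oplus>\<^bsub>B\<^esub> x') \<oplus>\<^bsub>B\<^esub> b \<triangleleft>\<^bsub>B\<^esub> (s \<oplus>\<^bsub>S\<^esub> s'), (y \<oplus>\<^bsub>E\<^esub> y') \<oplus>\<^bsub>E\<^esub> e0 \<triangleleft>\<^bsub>E\<^esub> (s \<oplus>\<^bsub>S\<^esub> s'))"
            using p q b e0(1) GC[OF p(1)] GC[OF q(1)]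
            by (simp add: rmod_sum_def B.rsmult_r_distr E.rsmult_r_distr B.rsmult_closed E.rsmult_closed
                B.M.a_assoc B.M.a_comm B.M.a_lcomm E.M.a_assoc E.M.a_comm E.M.a_lcomm)
          then show ?thesis using Gadd[OF p(1) q(1)] p(2) q(2) unfolding G'_def by blast
        qed
        show "p \<triangleleft>\<^bsub>rmod_sum B E\<^esub> r \<in> G'" if pG: "p \<in> G'" and r: "r \<in> carrier S" for p r
        proof -
          obtain x y s where p: "(x, y) \<in> G" "s \<in> carrier S" "p = (x \<oplus>\<^bsub>B\<^esub> b \<triangleleft>\<^bsub>B\<^esub> s, y \<oplus>\<^bsub>E\<^esub> e0 \<triangleleft>\<^bsub>E\<^esub> s)"
            using pG by (auto simp: G'_def)
          have "p \<triangleleft>\<^bsub>rmod_sum B E\<^esub> r = (x \<triangleleft>\<^bsub>B\<^esub> r \<oplus>\<^bsub>B\<^esub> b \<triangleleft>\<^bsub>B\<^esub> (s \<otimes>\<^bsub>S\<^esub> r), y \<triangleleft>\<^bsub>E\<^esub> r \<oplus>\<^bsub>E\<^esub> e0 \<triangleleft>\<^bsub>E\<^esub> (s \<otimes>\<^bsub>S\<^esub> r))"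
            using p b e0(1) GC[OF p(1)] r
            by (simp add: rmod_sum_def B.rsmult_l_distr E.rsmult_l_distr B.rsmult_closed E.rsmult_closed
                B.rsmult_assoc E.rsmult_assoc)
          then show ?thesis using Gsm[OF p(1) r] p(2) r unfolding G'_def by blast
        qed
      qed
      ultimately show ?thesis using \<open>G \<subseteq> G'\<close> Gfg by (auto simp: \<G>_def)
    qed
    ultimately show ?thesis using max by blast
  qed
  define h where "h = (\<lambda>b\<in>carrier B. THE e. (b, e) \<in> G)"
  have h: "h b = e" if "(b, e) \<in> G" for b e
    using that single GC by (auto simp: h_def)
  have hG: "(b, h b) \<in> G" if "b \<in> carrier B" for b using total[OF that] h by auto
  show ?thesis
  proof
    have "(\<lambda>b\<in>carrier B. h b) \<in> rmod_hom S B E"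
      by (rule rmod_hom_restrictI[OF B]) (auto intro!: h Gadd Gsm hG dest: hG GC)
    moreover have "restrict h (carrier B) = h" by (auto simp: h_def)
    ultimately show "h \<in> rmod_hom S B E" by simp
    show "h (f a) = g a" if "a \<in> carrier A" for a using h Gfg that by blast
  qed
qed

text \<open>\<open>N\<close> need not fit into \<open>'u\<close>, but the cyclic submodule generated
  by \<open>x\<close> does, being an image of \<open>T\<close>. Cogeneration gives a nonzero map on
  a copy of it, and injectivity extends that map to \<open>N\<close>. Both properties of
  \<open>F\<close> are used.\<close>

lemma cogenerator_separates:
  fixes T :: "('t, 'k) ring_scheme" and F :: "('t, 'f) rmodule" and N :: "('t, 'n) rmodule"
  assumes T: "ring T" "carrier T \<lesssim> (UNIV :: 'u set)"
    and F: "rmod_injective TYPE('u) T F" "rmod_cogenerator TYPE('u) T F"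
    and N: "right_module T N" and x: "x \<in> carrier N" "x \<noteq> \<zero>\<^bsub>N\<^esub>"
  obtains h where "h \<in> rmod_hom T N F" "h x \<noteq> \<zero>\<^bsub>F\<^esub>"
proof -
  have FR: "right_module T F" using F by (simp add: rmod_injective_def)
  interpret T: ring T by fact
  interpret N: right_module T N by fact
  define D where "D = (\<lambda>t. x \<triangleleft>\<^bsub>N\<^esub> t) ` carrier T"
  let ?D = "N\<lparr>carrier := D\<rparr>"
  have xD: "x \<in> D" unfolding D_def by (rule image_eqI[of _ _ "\<one>\<^bsub>T\<^esub>"]) (use x N.rsmult_one in auto)
  have D: "rsubmodule T N D"
    unfolding rsubmodule_def
  proof (intro conjI ballI)
    show "\<zero>\<^bsub>N\<^esub> \<in> D" unfolding D_def
      by (rule image_eqI[of _ _ "\<zero>\<^bsub>T\<^esub>"]) (use x N.rsmult_zero in auto)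
  qed (use x in \<open>auto simp: D_def N.rsmult_closed N.rsmult_r_distr[symmetric] N.rsmult_assoc[symmetric]\<close>)
  note DR = right_module_rsubmodule[OF N D]
  have "carrier ?D \<lesssim> carrier T" by (simp add: D_def image_lepoll)
  then have "carrier ?D \<lesssim> (UNIV :: 'u set)" using T(2) lepoll_trans by blast
  then obtain A :: "('t, 'u) rmodule" where "A \<in> copies T ?D" by (rule copies_nonempty[OF DR])
  then obtain i where A: "right_module T A" and i: "i \<in> rmod_hom T ?D A" "bij_betw i D (carrier A)"
    by (auto simp: copies_def rmod_iso_def)
  interpret A: right_module T A by fact
  \<comment> \<open>The parallel pair to be separated is the identity and the zero map of
    \<open>A\<close>; separating them means finding a map into \<open>F\<close> that does not vanish
    on \<open>A\<close>.\<close>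
  have 1: "(\<lambda>a\<in>carrier A. a) \<in> rmod_hom T A A" and 2: "(\<lambda>a\<in>carrier A. \<zero>\<^bsub>A\<^esub>) \<in> rmod_hom T A A"
    by (rule rmod_hom_restrictI[OF A]; simp add: A.zero_rsmult)+
  have i0: "i \<zero>\<^bsub>N\<^esub> = \<zero>\<^bsub>A\<^esub>" using rmod_hom_zero[OF DR A i(1)] by simp
  have "i x \<noteq> i \<zero>\<^bsub>N\<^esub>" using i(2) xD x D by (auto simp: bij_betw_def rsubmodule_def dest: inj_onD)
  moreover have ix: "i x \<in> carrier A" using rmod_hom_closed[OF i(1)] xD by simp
  ultimately have "(\<lambda>a\<in>carrier A. a) \<noteq> (\<lambda>a\<in>carrier A. \<zero>\<^bsub>A\<^esub>)" using i0
    by (metis restrict_apply')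
  then obtain h a where h: "h \<in> rmod_hom T A F" and a: "a \<in> carrier A" "h a \<noteq> h \<zero>\<^bsub>A\<^esub>"
    using F(2) A 1 2 unfolding rmod_cogenerator_def by (smt (verit, best) restrict_apply')
  have hi: "compose D h i \<in> rmod_hom T ?D F" using rmod_hom_compose[OF DR i(1) h] by simp
  have "inj_on (\<lambda>x\<in>D. x) (carrier ?D)" by (simp add: inj_on_def)
  from injective_extend[OF T F(1) DR N rmod_hom_inclusion[OF N D] this hi]
  obtain h' where h': "h' \<in> rmod_hom T N F" "\<And>y. y \<in> D \<Longrightarrow> h' y = h (i y)"
    by (auto simp: compose_def)
  have "h' x \<noteq> \<zero>\<^bsub>F\<^esub>"
  proof
    assume 0: "h' x = \<zero>\<^bsub>F\<^esub>"
    \<comment> \<open>The point \<open>a\<close> where \<open>h\<close> is nonzero need not be the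
      image of \<open>x\<close>, but it is the image of a multiple of \<open>x\<close>. If the
      extension vanished at \<open>x\<close>, it would vanish at all multiples.\<close>
    obtain t where t: "t \<in> carrier T" "a = i (x \<triangleleft>\<^bsub>N\<^esub> t)"
      using a(1) i(2) by (auto simp: bij_betw_def D_def)
    have "h a = h' (x \<triangleleft>\<^bsub>N\<^esub> t)" using h'(2) t by (auto simp: D_def)
    also have "\<dots> = \<zero>\<^bsub>F\<^esub>"
      using rmod_hom_rsmult[OF h'(1) x(1) t(1)] 0 right_module.zero_rsmult[OF FR t(1)] by simp
    also have "\<dots> = h \<zero>\<^bsub>A\<^esub>" using rmod_hom_zero[OF A FR h] by simp
    finally show False using a(2) by simp
  qed
  with h'(1) show ?thesis by (rule that)
qed

section \<open>The endomorphism ring\<close>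

context left_module
begin

lemma smult_zero: "r \<in> carrier R \<Longrightarrow> r \<odot>\<^bsub>M\<^esub> \<zero>\<^bsub>M\<^esub> = \<zero>\<^bsub>M\<^esub>"
  using smult_r_distr[of r "\<zero>\<^bsub>M\<^esub>" "\<zero>\<^bsub>M\<^esub>"] smult_closed[of r "\<zero>\<^bsub>M\<^esub>"]
  by (metis M.zero_closed M.r_zero M.add.r_cancel_one')

lemma smult_minus:
  assumes "r \<in> carrier R" "x \<in> carrier M"
  shows "r \<odot>\<^bsub>M\<^esub> (\<ominus>\<^bsub>M\<^esub> x) = \<ominus>\<^bsub>M\<^esub> (r \<odot>\<^bsub>M\<^esub> x)"
  using assms smult_r_distr[of r "\<ominus>\<^bsub>M\<^esub> x" x] smult_closed
  by (metis M.a_inv_closed M.l_neg M.minus_equality smult_zero)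

end

lemma lmod_hom_closed: "\<lbrakk>f \<in> lmod_hom R A B; x \<in> carrier A\<rbrakk> \<Longrightarrow> f x \<in> carrier B"
  and lmod_hom_add: "\<lbrakk>f \<in> lmod_hom R A B; x \<in> carrier A; y \<in> carrier A\<rbrakk> \<Longrightarrow> f (x \<oplus>\<^bsub>A\<^esub> y) = f x \<oplus>\<^bsub>B\<^esub> f y"
  and lmod_hom_smult: "\<lbrakk>f \<in> lmod_hom R A B; r \<in> carrier R; x \<in> carrier A\<rbrakk> \<Longrightarrow> f (r \<odot>\<^bsub>A\<^esub> x) = r \<odot>\<^bsub>B\<^esub> f x"
  and lmod_hom_extensional: "f \<in> lmod_hom R A B \<Longrightarrow> f \<in> extensional (carrier A)"
  by (auto simp: lmod_hom_def PiE_def)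

lemma lmod_hom_eqI:
  "\<lbrakk>f \<in> lmod_hom R A B; g \<in> lmod_hom R A B; \<And>x. x \<in> carrier A \<Longrightarrow> f x = g x\<rbrakk> \<Longrightarrow> f = g"
  by (meson lmod_hom_extensional extensionalityI)

lemma lmod_hom_restrictI:
  assumes "left_module R A"
    and "\<And>x. x \<in> carrier A \<Longrightarrow> f x \<in> carrier B"
    and "\<And>x y. \<lbrakk>x \<in> carrier A; y \<in> carrier A\<rbrakk> \<Longrightarrow> f (x \<oplus>\<^bsub>A\<^esub> y) = f x \<oplus>\<^bsub>B\<^esub> f y"
    and "\<And>r x. \<lbrakk>r \<in> carrier R; x \<in> carrier A\<rbrakk> \<Longrightarrow> f (r \<odot>\<^bsub>A\<^esub> x) = r \<odot>\<^bsub>B\<^esub> f x"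
  shows "(\<lambda>x\<in>carrier A. f x) \<in> lmod_hom R A B"
proof -
  interpret A: left_module R A by fact
  show ?thesis using assms by (auto simp: lmod_hom_def A.smult_closed)
qed

lemma End_ring_simps:
  "carrier (End_ring R M) = lmod_hom R M M"
  "x \<in> carrier M \<Longrightarrow> (f \<otimes>\<^bsub>End_ring R M\<^esub> g) x = g (f x)"
  "x \<in> carrier M \<Longrightarrow> \<one>\<^bsub>End_ring R M\<^esub> x = x"
  "x \<in> carrier M \<Longrightarrow> \<zero>\<^bsub>End_ring R M\<^esub> x = \<zero>\<^bsub>M\<^esub>"
  "x \<in> carrier M \<Longrightarrow> (f \<oplus>\<^bsub>End_ring R M\<^esub> g) x = f x \<oplus>\<^bsub>M\<^esub> g x"
  by (simp_all add: End_ring_def compose_def)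

lemma ring_End_ring:
  assumes "left_module R M"
  shows "ring (End_ring R M)"
proof -
  interpret M: left_module R M by fact
  let ?C = "End_ring R M"
  have mult: "f \<otimes>\<^bsub>?C\<^esub> g \<in> lmod_hom R M M" if "f \<in> lmod_hom R M M" "g \<in> lmod_hom R M M" for f g
    unfolding End_ring_def compose_def using that
    by simp (rule lmod_hom_restrictI[OF assms], simp_all add: lmod_hom_closed lmod_hom_add lmod_hom_smult)
  have add: "f \<oplus>\<^bsub>?C\<^esub> g \<in> lmod_hom R M M" if "f \<in> lmod_hom R M M" "g \<in> lmod_hom R M M" for f g
    unfolding End_ring_def using that
    by simp (rule lmod_hom_restrictI[OF assms], simp_all add: lmod_hom_closed lmod_hom_add lmod_hom_smult
        M.smult_r_distr M.M.a_ac)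
  have one: "\<one>\<^bsub>?C\<^esub> \<in> lmod_hom R M M"
    unfolding End_ring_def by simp (rule lmod_hom_restrictI[OF assms], simp_all)
  have zero: "\<zero>\<^bsub>?C\<^esub> \<in> lmod_hom R M M"
    unfolding End_ring_def by simp (rule lmod_hom_restrictI[OF assms], simp_all add: M.smult_zero)
  have neg: "(\<lambda>x\<in>carrier M. \<ominus>\<^bsub>M\<^esub> f x) \<in> lmod_hom R M M" if "f \<in> lmod_hom R M M" for f
    using that by (intro lmod_hom_restrictI[OF assms])
      (simp_all add: lmod_hom_closed lmod_hom_add lmod_hom_smult M.smult_minus M.M.minus_add)
  have cl: "f x \<in> carrier M" if "f \<in> lmod_hom R M M" "x \<in> carrier M" for f x
    using that by (rule lmod_hom_closed)
  note eqI = lmod_hom_eqI[of _ R M M] and simps = End_ring_simps[where R = R and M = M] mult add one zero cl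
  show ?thesis
  proof (rule ringI)
    show "abelian_group ?C"
    proof (rule abelian_groupI; (simp only: End_ring_simps(1))?)
      fix f g h assume fgh: "f \<in> lmod_hom R M M" "g \<in> lmod_hom R M M" "h \<in> lmod_hom R M M"
      then show "(f \<oplus>\<^bsub>?C\<^esub> g) \<oplus>\<^bsub>?C\<^esub> h = f \<oplus>\<^bsub>?C\<^esub> (g \<oplus>\<^bsub>?C\<^esub> h)"
        by (intro eqI) (simp_all add: simps M.M.a_assoc)
      show "f \<oplus>\<^bsub>?C\<^esub> g = g \<oplus>\<^bsub>?C\<^esub> f"
        using fgh by (intro eqI) (simp_all add: simps M.M.a_comm)
      show "\<zero>\<^bsub>?C\<^esub> \<oplus>\<^bsub>?C\<^esub> f = f" using fgh by (intro eqI) (simp_all add: simps)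
      have "(\<lambda>x\<in>carrier M. \<ominus>\<^bsub>M\<^esub> f x) \<oplus>\<^bsub>?C\<^esub> f = \<zero>\<^bsub>?C\<^esub>"
        using fgh neg[OF fgh(1)] by (intro eqI) (simp_all add: simps M.M.l_neg)
      then show "\<exists>g\<in>lmod_hom R M M. g \<oplus>\<^bsub>?C\<^esub> f = \<zero>\<^bsub>?C\<^esub>" using neg[OF fgh(1)] by blast
      show "f \<oplus>\<^bsub>?C\<^esub> g \<in> lmod_hom R M M" using fgh add by blast
    qed (rule zero)
    show "monoid ?C"
    proof (rule monoidI; (simp only: End_ring_simps(1))?)
      fix f g h assume fgh: "f \<in> lmod_hom R M M" "g \<in> lmod_hom R M M" "h \<in> lmod_hom R M M"
      then show "(f \<otimes>\<^bsub>?C\<^esub> g) \<otimes>\<^bsub>?C\<^esub> h = f \<otimes>\<^bsub>?C\<^esub> (g \<otimes>\<^bsub>?C\<^esub> h)"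
        by (intro eqI) (simp_all add: simps)
      show "\<one>\<^bsub>?C\<^esub> \<otimes>\<^bsub>?C\<^esub> f = f" "f \<otimes>\<^bsub>?C\<^esub> \<one>\<^bsub>?C\<^esub> = f"
        using fgh by (intro eqI; simp add: simps)+
      show "f \<otimes>\<^bsub>?C\<^esub> g \<in> lmod_hom R M M" using fgh mult by blast
    qed (rule one)
    fix f g h assume fgh: "f \<in> carrier ?C" "g \<in> carrier ?C" "h \<in> carrier ?C"
    note fgh = this[unfolded End_ring_simps(1)]
    then show "(f \<oplus>\<^bsub>?C\<^esub> g) \<otimes>\<^bsub>?C\<^esub> h = f \<otimes>\<^bsub>?C\<^esub> h \<oplus>\<^bsub>?C\<^esub> g \<otimes>\<^bsub>?C\<^esub> h"
      by (intro eqI) (simp_all add: simps lmod_hom_add[of h R M M])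
    show "h \<otimes>\<^bsub>?C\<^esub> (f \<oplus>\<^bsub>?C\<^esub> g) = h \<otimes>\<^bsub>?C\<^esub> f \<oplus>\<^bsub>?C\<^esub> h \<otimes>\<^bsub>?C\<^esub> g"
      using fgh by (intro eqI) (simp_all add: simps)
  qed
qed

section \<open>Dual modules\<close>

text \<open>This is the bimodule structure. The action is a right action because the product in
  \<open>End_ring\<close> applies its left factor first, and it commutes with \<open>R\<close>
  because every \<open>\<phi> s\<close> is \<open>R\<close>-linear.\<close>

lemma
  assumes "left_module R M" "ring S" "\<phi> \<in> ring_hom S (End_ring R M)"
  shows right_module_of_hom: "right_module S (rmod_of_hom M \<phi>)"
    and rmod_of_hom_smult:
      "\<lbrakk>s \<in> carrier S; r \<in> carrier R; m \<in> carrier M\<rbrakk> \<Longrightarrow> \<phi> s (r \<odot>\<^bsub>M\<^esub> m) = r \<odot>\<^bsub>M\<^esub> \<phi> s m"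
proof -
  interpret M: left_module R M by fact
  have hom: "\<phi> s \<in> lmod_hom R M M" if "s \<in> carrier S" for s
    using ring_hom_closed[OF assms(3) that] by (simp add: End_ring_simps)
  note hs = hom[THEN lmod_hom_closed] hom[THEN lmod_hom_add] hom[THEN lmod_hom_smult]
    ring_hom_add[OF assms(3)] ring_hom_mult[OF assms(3)] ring_hom_one[OF assms(3)]
  show "right_module S (rmod_of_hom M \<phi>)"
  proof (rule right_moduleI[OF assms(2)])
    show "\<exists>y\<in>carrier (rmod_of_hom M \<phi>). y \<oplus>\<^bsub>rmod_of_hom M \<phi>\<^esub> x = \<zero>\<^bsub>rmod_of_hom M \<phi>\<^esub>"
      if "x \<in> carrier (rmod_of_hom M \<phi>)" for x
      using that by (intro bexI[of _ "\<ominus>\<^bsub>M\<^esub> x"]) (simp_all add: rmod_of_hom_def M.M.l_neg)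
  qed (simp_all add: rmod_of_hom_def hs End_ring_simps M.M.a_ac)
  show "\<phi> s (r \<odot>\<^bsub>M\<^esub> m) = r \<odot>\<^bsub>M\<^esub> \<phi> s m" if "s \<in> carrier S" "r \<in> carrier R" "m \<in> carrier M"
    using that by (simp add: hs)
qed

lemma dual_module_simps:
  "carrier (dual_module M S \<phi> E) = rmod_hom S (rmod_of_hom M \<phi>) E"
  "m \<in> carrier M \<Longrightarrow> \<zero>\<^bsub>dual_module M S \<phi> E\<^esub> m = \<zero>\<^bsub>E\<^esub>"
  "m \<in> carrier M \<Longrightarrow> (f \<oplus>\<^bsub>dual_module M S \<phi> E\<^esub> g) m = f m \<oplus>\<^bsub>E\<^esub> g m"
  "m \<in> carrier M \<Longrightarrow> (f \<triangleleft>\<^bsub>dual_module M S \<phi> E\<^esub> r) m = f (r \<odot>\<^bsub>M\<^esub> m)"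
  by (simp_all add: dual_module_def)

lemma rmod_of_hom_simps:
  "carrier (rmod_of_hom M \<phi>) = carrier M"
  "x \<oplus>\<^bsub>rmod_of_hom M \<phi>\<^esub> y = x \<oplus>\<^bsub>M\<^esub> y"
  "x \<triangleleft>\<^bsub>rmod_of_hom M \<phi>\<^esub> s = \<phi> s x"
  by (simp_all add: rmod_of_hom_def)

lemma dual_module_closed: "\<lbrakk>f \<in> carrier (dual_module M S \<phi> E); m \<in> carrier M\<rbrakk> \<Longrightarrow> f m \<in> carrier E"
  and dual_module_add: "\<lbrakk>f \<in> carrier (dual_module M S \<phi> E); m \<in> carrier M; n \<in> carrier M\<rbrakk> \<Longrightarrow>
    f (m \<oplus>\<^bsub>M\<^esub> n) = f m \<oplus>\<^bsub>E\<^esub> f n"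
  and dual_module_act: "\<lbrakk>f \<in> carrier (dual_module M S \<phi> E); m \<in> carrier M; s \<in> carrier S\<rbrakk> \<Longrightarrow>
    f (\<phi> s m) = f m \<triangleleft>\<^bsub>E\<^esub> s"
  using rmod_hom_closed[of f S "rmod_of_hom M \<phi>" E] rmod_hom_add[of f S "rmod_of_hom M \<phi>" E]
    rmod_hom_rsmult[of f S "rmod_of_hom M \<phi>" E]
  by (simp_all add: dual_module_simps rmod_of_hom_simps)

lemma dual_module_eqI:
  "\<lbrakk>f \<in> carrier (dual_module M S \<phi> E); g \<in> carrier (dual_module M S \<phi> E); \<And>m. m \<in> carrier M \<Longrightarrow> f m = g m\<rbrakk> \<Longrightarrow> f = g"
  by (auto simp: dual_module_simps rmod_of_hom_simps intro: rmod_hom_eqI)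

lemma dual_module_restrictI:
  assumes "right_module S (rmod_of_hom M \<phi>)"
    and "\<And>m. m \<in> carrier M \<Longrightarrow> f m \<in> carrier E"
    and "\<And>m n. \<lbrakk>m \<in> carrier M; n \<in> carrier M\<rbrakk> \<Longrightarrow> f (m \<oplus>\<^bsub>M\<^esub> n) = f m \<oplus>\<^bsub>E\<^esub> f n"
    and "\<And>m s. \<lbrakk>m \<in> carrier M; s \<in> carrier S\<rbrakk> \<Longrightarrow> f (\<phi> s m) = f m \<triangleleft>\<^bsub>E\<^esub> s"
  shows "(\<lambda>m\<in>carrier M. f m) \<in> carrier (dual_module M S \<phi> E)"
  using rmod_hom_restrictI[OF assms(1), of f E] assms(2-)
  by (simp add: dual_module_simps rmod_of_hom_simps)

text \<open>Commutation of the two actions is what keeps \<open>f r\<close> linear over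
  \<open>S\<close>. It is assumed in the abstract form \<open>comm\<close>, without reference to an
  endomorphism ring, so that the lemma serves both the dual of \<open>M\<close> and the coinduced
  modules, where \<open>M\<close> is replaced by the ring \<open>C\<close>.\<close>

lemma right_module_dual:
  assumes M: "left_module R M" and MS: "right_module S (rmod_of_hom M \<phi>)" and E: "right_module S E"
    and comm: "\<And>s r m. \<lbrakk>s \<in> carrier S; r \<in> carrier R; m \<in> carrier M\<rbrakk> \<Longrightarrow> \<phi> s (r \<odot>\<^bsub>M\<^esub> m) = r \<odot>\<^bsub>M\<^esub> \<phi> s m"
  shows "right_module R (dual_module M S \<phi> E)"
proof -
  interpret M: left_module R M by fact
  interpret MS: right_module S "rmod_of_hom M \<phi>" by fact
  interpret E: right_module S E by fact
  let ?X = "dual_module M S \<phi> E"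
  note restrictI = dual_module_restrictI[OF MS, of _ E]
  have act: "\<phi> s m \<in> carrier M" if "m \<in> carrier M" "s \<in> carrier S" for m s
    using MS.rsmult_closed that by (simp add: rmod_of_hom_simps)
  note [simp] = dual_module_closed[of _ M S \<phi> E] dual_module_add[of _ M S \<phi> E] dual_module_act[of _ M S \<phi> E]
  have add: "f \<oplus>\<^bsub>?X\<^esub> g \<in> carrier ?X" if "f \<in> carrier ?X" "g \<in> carrier ?X" for f g
  proof -
    have "(\<lambda>m\<in>carrier M. f m \<oplus>\<^bsub>E\<^esub> g m) \<in> carrier ?X"
      using that by (intro restrictI) (simp_all add: E.M.a_ac E.rsmult_l_distr)
    then show ?thesis by (simp add: dual_module_def)
  qed
  have zero: "\<zero>\<^bsub>?X\<^esub> \<in> carrier ?X"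
  proof -
    have "(\<lambda>m\<in>carrier M. \<zero>\<^bsub>E\<^esub>) \<in> carrier ?X" by (intro restrictI) (simp_all add: E.zero_rsmult)
    then show ?thesis by (simp add: dual_module_def)
  qed
  have smult: "f \<triangleleft>\<^bsub>?X\<^esub> r \<in> carrier ?X" if "f \<in> carrier ?X" "r \<in> carrier R" for f r
  proof -
    have "(\<lambda>m\<in>carrier M. f (r \<odot>\<^bsub>M\<^esub> m)) \<in> carrier ?X"
      using that by (intro restrictI) (simp_all add: M.smult_closed M.smult_r_distr comm[symmetric])
    then show ?thesis by (simp add: dual_module_def)
  qed
  \<comment> \<open>The negative of \<open>f\<close> is written with the action of minus one on
    \<open>E\<close>. It is \<open>S\<close>-linear because minus one commutes with every
    scalar.\<close>
  have neg: "(\<lambda>m\<in>carrier M. f m \<triangleleft>\<^bsub>E\<^esub> (\<ominus>\<^bsub>S\<^esub> \<one>\<^bsub>S\<^esub>)) \<in> carrier ?X" if "f \<in> carrier ?X" for f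
  proof (rule restrictI)
    fix m s assume "m \<in> carrier M" "s \<in> carrier S"
    then show "f (\<phi> s m) \<triangleleft>\<^bsub>E\<^esub> (\<ominus>\<^bsub>S\<^esub> \<one>\<^bsub>S\<^esub>) = f m \<triangleleft>\<^bsub>E\<^esub> (\<ominus>\<^bsub>S\<^esub> \<one>\<^bsub>S\<^esub>) \<triangleleft>\<^bsub>E\<^esub> s"
      using that by (simp add: E.rsmult_assoc[symmetric] MS.R.l_minus MS.R.r_minus)
  qed (use that in \<open>simp_all add: E.rsmult_closed E.rsmult_l_distr\<close>)
  note eqI = dual_module_eqI[of _ M S \<phi> E] and simps = dual_module_simps(2-) add zero smult
  show ?thesis
  proof (rule right_moduleI)
    show "ring R" by (rule M.R.ring_axioms)
    fix f g h r s assume fgh: "f \<in> carrier ?X" "g \<in> carrier ?X" "h \<in> carrier ?X"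
    then show "f \<oplus>\<^bsub>?X\<^esub> g \<oplus>\<^bsub>?X\<^esub> h = f \<oplus>\<^bsub>?X\<^esub> (g \<oplus>\<^bsub>?X\<^esub> h)"
      by (intro eqI) (simp_all add: simps E.M.a_assoc)
    show "f \<oplus>\<^bsub>?X\<^esub> g = g \<oplus>\<^bsub>?X\<^esub> f" using fgh by (intro eqI) (simp_all add: simps E.M.a_comm)
    show "\<zero>\<^bsub>?X\<^esub> \<oplus>\<^bsub>?X\<^esub> f = f" using fgh by (intro eqI) (simp_all add: simps)
    have "(\<lambda>m\<in>carrier M. f m \<triangleleft>\<^bsub>E\<^esub> (\<ominus>\<^bsub>S\<^esub> \<one>\<^bsub>S\<^esub>)) \<oplus>\<^bsub>?X\<^esub> f = \<zero>\<^bsub>?X\<^esub>"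
      using fgh neg[OF fgh(1)] by (intro eqI) (simp_all add: simps E.rsmult_minus_one)
    then show "\<exists>g\<in>carrier ?X. g \<oplus>\<^bsub>?X\<^esub> f = \<zero>\<^bsub>?X\<^esub>" using neg[OF fgh(1)] by blast
    show "f \<triangleleft>\<^bsub>?X\<^esub> \<one>\<^bsub>R\<^esub> = f" using fgh by (intro eqI) (simp_all add: simps M.smult_one)
    assume r: "r \<in> carrier R"
    then show "(f \<oplus>\<^bsub>?X\<^esub> g) \<triangleleft>\<^bsub>?X\<^esub> r = f \<triangleleft>\<^bsub>?X\<^esub> r \<oplus>\<^bsub>?X\<^esub> g \<triangleleft>\<^bsub>?X\<^esub> r"
      using fgh by (intro eqI) (simp_all add: simps M.smult_closed)
    assume s: "s \<in> carrier R"
    then show "f \<triangleleft>\<^bsub>?X\<^esub> (r \<oplus>\<^bsub>R\<^esub> s) = f \<triangleleft>\<^bsub>?X\<^esub> r \<oplus>\<^bsub>?X\<^esub> f \<triangleleft>\<^bsub>?X\<^esub> s"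
      using fgh r by (intro eqI) (simp_all add: simps M.smult_closed M.smult_l_distr)
    show "f \<triangleleft>\<^bsub>?X\<^esub> (r \<otimes>\<^bsub>R\<^esub> s) = f \<triangleleft>\<^bsub>?X\<^esub> r \<triangleleft>\<^bsub>?X\<^esub> s"
      using fgh r s by (intro eqI) (simp_all add: simps M.smult_closed M.smult_assoc)
  qed (simp_all add: simps)
qed

section \<open>Coinduced modules\<close>

text \<open>Restriction of scalars along \<open>\<chi>\<close>. In the proof one and the same
  \<open>C\<close>-module is viewed both over \<open>S\<close> and over \<open>T\<close>.\<close>

definition rmod_restrict :: "('s \<Rightarrow> 'c) \<Rightarrow> ('c, 'x) rmodule \<Rightarrow> ('s, 'x) rmodule"
  where "rmod_restrict \<chi> N = \<lparr>carrier = carrier N, mult = undefined, one = undefined,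
    zero = \<zero>\<^bsub>N\<^esub>, add = (\<oplus>\<^bsub>N\<^esub>), rsmult = (\<lambda>x s. x \<triangleleft>\<^bsub>N\<^esub> \<chi> s)\<rparr>"

lemma rmod_restrict_simps:
  "carrier (rmod_restrict \<chi> N) = carrier N"
  "\<zero>\<^bsub>rmod_restrict \<chi> N\<^esub> = \<zero>\<^bsub>N\<^esub>"
  "x \<oplus>\<^bsub>rmod_restrict \<chi> N\<^esub> y = x \<oplus>\<^bsub>N\<^esub> y"
  "x \<triangleleft>\<^bsub>rmod_restrict \<chi> N\<^esub> s = x \<triangleleft>\<^bsub>N\<^esub> \<chi> s"
  by (simp_all add: rmod_restrict_def)

lemma right_module_restrict:
  assumes "ring S" "\<chi> \<in> ring_hom S C" "right_module C N"
  shows "right_module S (rmod_restrict \<chi> N)"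
proof -
  interpret N: right_module C N by fact
  note [simp] = ring_hom_closed[OF assms(2)] ring_hom_add[OF assms(2)] ring_hom_mult[OF assms(2)]
    ring_hom_one[OF assms(2)]
  show ?thesis
  proof (rule right_moduleI[OF assms(1)])
    show "\<exists>y\<in>carrier (rmod_restrict \<chi> N). y \<oplus>\<^bsub>rmod_restrict \<chi> N\<^esub> x = \<zero>\<^bsub>rmod_restrict \<chi> N\<^esub>"
      if "x \<in> carrier (rmod_restrict \<chi> N)" for x
      using that by (intro bexI[of _ "\<ominus>\<^bsub>N\<^esub> x"]) (simp_all add: rmod_restrict_simps N.M.l_neg)
  qed (simp_all add: rmod_restrict_simps N.M.a_ac N.rsmult_closed N.rsmult_l_distr N.rsmult_r_distr
      N.rsmult_assoc N.rsmult_one)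
qed

definition regular_lmodule :: "('c, 'k) ring_scheme \<Rightarrow> ('c, 'c) module"
  where "regular_lmodule C = \<lparr>carrier = carrier C, mult = undefined, one = undefined,
    zero = \<zero>\<^bsub>C\<^esub>, add = (\<oplus>\<^bsub>C\<^esub>), smult = (\<otimes>\<^bsub>C\<^esub>)\<rparr>"

lemma regular_lmodule_simps:
  "carrier (regular_lmodule C) = carrier C"
  "x \<oplus>\<^bsub>regular_lmodule C\<^esub> y = x \<oplus>\<^bsub>C\<^esub> y"
  "x \<odot>\<^bsub>regular_lmodule C\<^esub> y = x \<otimes>\<^bsub>C\<^esub> y"
  by (simp_all add: regular_lmodule_def)

text \<open>This is \<open>Hom\<^sub>S(C, E)\<close>, the right adjoint of restriction of scalars
  applied to \<open>E\<close>. Writing it as the dual of the regular left module of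
  \<open>C\<close>, with \<open>S\<close> acting on the right through \<open>\<chi>\<close>, makes
  the general facts on \<open>dual_module\<close> available.\<close>

definition coinduced ::
  "('c, 'k) ring_scheme \<Rightarrow> ('s, 'l) ring_scheme \<Rightarrow> ('s \<Rightarrow> 'c) \<Rightarrow> ('s, 'e) rmodule \<Rightarrow> ('c, 'c \<Rightarrow> 'e) rmodule"
  where "coinduced C S \<chi> E = dual_module (regular_lmodule C) S (\<lambda>s c. c \<otimes>\<^bsub>C\<^esub> \<chi> s) E"

lemma coinduced_simps:
  "c \<in> carrier C \<Longrightarrow> \<zero>\<^bsub>coinduced C S \<chi> E\<^esub> c = \<zero>\<^bsub>E\<^esub>"
  "c \<in> carrier C \<Longrightarrow> (f \<oplus>\<^bsub>coinduced C S \<chi> E\<^esub> g) c = f c \<oplus>\<^bsub>E\<^esub> g c"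
  "c \<in> carrier C \<Longrightarrow> (f \<triangleleft>\<^bsub>coinduced C S \<chi> E\<^esub> d) c = f (d \<otimes>\<^bsub>C\<^esub> c)"
  unfolding coinduced_def by (simp_all add: dual_module_simps regular_lmodule_simps)

lemma coinduced_closed: "\<lbrakk>f \<in> carrier (coinduced C S \<chi> E); c \<in> carrier C\<rbrakk> \<Longrightarrow> f c \<in> carrier E"
  and coinduced_act: "\<lbrakk>f \<in> carrier (coinduced C S \<chi> E); c \<in> carrier C; s \<in> carrier S\<rbrakk> \<Longrightarrow>
    f (c \<otimes>\<^bsub>C\<^esub> \<chi> s) = f c \<triangleleft>\<^bsub>E\<^esub> s"
  using dual_module_closed[of f "regular_lmodule C" S "\<lambda>s c. c \<otimes>\<^bsub>C\<^esub> \<chi> s" E c]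
    dual_module_act[of f "regular_lmodule C" S "\<lambda>s c. c \<otimes>\<^bsub>C\<^esub> \<chi> s" E c s]
  by (simp_all add: coinduced_def regular_lmodule_simps)

lemma coinduced_eqI:
  "\<lbrakk>f \<in> carrier (coinduced C S \<chi> E); g \<in> carrier (coinduced C S \<chi> E); \<And>c. c \<in> carrier C \<Longrightarrow> f c = g c\<rbrakk> \<Longrightarrow> f = g"
  unfolding coinduced_def by (rule dual_module_eqI) (auto simp: regular_lmodule_simps)

lemma
  assumes C: "ring C" and S: "ring S" and \<chi>: "\<chi> \<in> ring_hom S C"
  shows left_module_regular: "left_module C (regular_lmodule C)"
    and right_module_regular_of_hom: "right_module S (rmod_of_hom (regular_lmodule C) (\<lambda>s c. c \<otimes>\<^bsub>C\<^esub> \<chi> s))"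
proof -
  interpret C: ring C by fact
  note [simp] = ring_hom_closed[OF \<chi>] ring_hom_add[OF \<chi>] ring_hom_mult[OF \<chi>] ring_hom_one[OF \<chi>]
  show "left_module C (regular_lmodule C)"
    by (intro left_module.intro left_module_axioms.intro abelian_groupI)
      (auto simp: regular_lmodule_def C.a_ac C.l_distr C.r_distr C.m_assoc intro: C.ring_axioms
        bexI[of _ "\<ominus>\<^bsub>C\<^esub> _"] C.l_neg)
  have "rmod_of_hom (regular_lmodule C) (\<lambda>s c. c \<otimes>\<^bsub>C\<^esub> \<chi> s) = rmod_restrict \<chi> (regular_rmodule C)"
    by (simp add: rmod_of_hom_def regular_lmodule_def rmod_restrict_def regular_rmodule_def)
  then show "right_module S (rmod_of_hom (regular_lmodule C) (\<lambda>s c. c \<otimes>\<^bsub>C\<^esub> \<chi> s))"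
    using right_module_restrict[OF S \<chi> right_module_regular[OF C]] by simp
qed

lemma right_module_coinduced:
  assumes C: "ring C" and S: "ring S" and \<chi>: "\<chi> \<in> ring_hom S C" and E: "right_module S E"
  shows "right_module C (coinduced C S \<chi> E)"
  unfolding coinduced_def
proof (rule right_module_dual[OF left_module_regular[OF C S \<chi>] right_module_regular_of_hom[OF C S \<chi>] E])
  interpret C: ring C by fact
  show "(r \<odot>\<^bsub>regular_lmodule C\<^esub> m) \<otimes>\<^bsub>C\<^esub> \<chi> s = r \<odot>\<^bsub>regular_lmodule C\<^esub> (m \<otimes>\<^bsub>C\<^esub> \<chi> s)"
    if "s \<in> carrier S" "r \<in> carrier C" "m \<in> carrier (regular_lmodule C)" for s r m
    using that ring_hom_closed[OF \<chi>] by (simp add: regular_lmodule_simps C.m_assoc)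
qed

lemma coinduced_restrictI:
  assumes "ring C" "ring S" "\<chi> \<in> ring_hom S C"
    and "\<And>c. c \<in> carrier C \<Longrightarrow> f c \<in> carrier E"
    and "\<And>c d. \<lbrakk>c \<in> carrier C; d \<in> carrier C\<rbrakk> \<Longrightarrow> f (c \<oplus>\<^bsub>C\<^esub> d) = f c \<oplus>\<^bsub>E\<^esub> f d"
    and "\<And>c s. \<lbrakk>c \<in> carrier C; s \<in> carrier S\<rbrakk> \<Longrightarrow> f (c \<otimes>\<^bsub>C\<^esub> \<chi> s) = f c \<triangleleft>\<^bsub>E\<^esub> s"
  shows "(\<lambda>c\<in>carrier C. f c) \<in> carrier (coinduced C S \<chi> E)"
  using dual_module_restrictI[OF right_module_regular_of_hom[OF assms(1-3)], of f E] assms(4-)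
  by (simp add: coinduced_def regular_lmodule_simps)

lemma rmod_hom_inj_onI:
  assumes "right_module R A" "right_module R B" "f \<in> rmod_hom R A B"
    and "\<And>x. \<lbrakk>x \<in> carrier A; f x = \<zero>\<^bsub>B\<^esub>\<rbrakk> \<Longrightarrow> x = \<zero>\<^bsub>A\<^esub>"
  shows "inj_on f (carrier A)"
proof (rule inj_onI)
  interpret A: right_module R A by fact
  interpret B: right_module R B by fact
  fix x y assume xy: "x \<in> carrier A" "y \<in> carrier A" "f x = f y"
  have "f (x \<oplus>\<^bsub>A\<^esub> (\<ominus>\<^bsub>A\<^esub> y)) = f (y \<oplus>\<^bsub>A\<^esub> (\<ominus>\<^bsub>A\<^esub> y))"
    using xy by (simp add: rmod_hom_add[OF assms(3)] del: A.M.r_neg)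
  also have "\<dots> = \<zero>\<^bsub>B\<^esub>" using xy rmod_hom_zero[OF assms(1-3)] by (simp add: A.M.r_neg)
  finally have "x \<oplus>\<^bsub>A\<^esub> (\<ominus>\<^bsub>A\<^esub> y) = \<zero>\<^bsub>A\<^esub>" using assms(4) xy by simp
  then show "x = y" using xy by (metis A.M.a_inv_closed A.M.minus_minus A.M.minus_equality)
qed

text \<open>
  The coinduced module \<open>E' = Hom\<^sub>S(C, E)\<close> embeds into a power of \<open>F' = Hom\<^sub>T(C, F)\<close> because \<open>F\<close> is a
  cogenerator, and a \<open>C\<close>-linear retraction amounts by adjunction to an \<open>S\<close>-linear map from the power
  to \<open>E\<close> that extends evaluation at \<open>\<one>\<close>.
\<close>

lemma coinduced_retraction:
  fixes E :: "('s, 'e) rmodule" and F :: "('t, 'f) rmodule" and C :: "'c ring"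
    and S :: "'s ring" and T :: "'t ring"
  assumes C: "ring C"
    and S: "ring S" "carrier S \<lesssim> (UNIV :: 'u set)" "\<phi> \<in> ring_hom S C"
    and T: "ring T" "carrier T \<lesssim> (UNIV :: 'u set)" "\<psi> \<in> ring_hom T C"
    and E: "rmod_injective TYPE('u) S E"
    and F: "rmod_injective TYPE('u) T F" "rmod_cogenerator TYPE('u) T F"
  defines "E' \<equiv> coinduced C S \<phi> E" and "F' \<equiv> coinduced C T \<psi> F"
  defines "J \<equiv> rmod_hom T (rmod_restrict \<psi> E') F"
  obtains \<theta> where "\<theta> \<in> rmod_hom S (rmod_restrict \<phi> (rmod_prod J (\<lambda>_. F'))) E"
    and "\<And>e. e \<in> carrier E' \<Longrightarrow> \<theta> (\<lambda>j\<in>J. \<lambda>c\<in>carrier C. j (e \<triangleleft>\<^bsub>E'\<^esub> c)) = e \<one>\<^bsub>C\<^esub>"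
proof -
  have ER: "right_module S E" and FR: "right_module T F" using E F by (simp_all add: rmod_injective_def)
  interpret C: ring C by fact
  have E'R: "right_module C E'" and F'R: "right_module C F'"
    unfolding E'_def F'_def using right_module_coinduced[OF C S(1,3) ER] right_module_coinduced[OF C T(1,3) FR] by simp_all
  interpret E': right_module C E' by fact
  interpret F: right_module T F by fact
  let ?P = "rmod_prod J (\<lambda>_. F')"
  have PR: "right_module C ?P" by (rule right_module_prod[OF C]) (rule F'R)
  have E'S: "right_module S (rmod_restrict \<phi> E')" and E'T: "right_module T (rmod_restrict \<psi> E')"
    and PS: "right_module S (rmod_restrict \<phi> ?P)"
    by (rule right_module_restrict[OF S(1,3) E'R] right_module_restrict[OF T(1,3) E'R]
        right_module_restrict[OF S(1,3) PR])+
  have jadd: "j (x \<oplus>\<^bsub>E'\<^esub> y) = j x \<oplus>\<^bsub>F\<^esub> j y" if "j \<in> J" "x \<in> carrier E'" "y \<in> carrier E'" for j x y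
    using that rmod_hom_add[of j T "rmod_restrict \<psi> E'" F] by (simp add: J_def rmod_restrict_simps)
  have jcl: "j x \<in> carrier F" if "j \<in> J" "x \<in> carrier E'" for j x
    using that rmod_hom_closed[of j T "rmod_restrict \<psi> E'" F] by (simp add: J_def rmod_restrict_simps)
  have jact: "j (x \<triangleleft>\<^bsub>E'\<^esub> \<psi> t) = j x \<triangleleft>\<^bsub>F\<^esub> t" if "j \<in> J" "x \<in> carrier E'" "t \<in> carrier T" for j x t
    using that rmod_hom_rsmult[of j T "rmod_restrict \<psi> E'" F] by (simp add: J_def rmod_restrict_simps)
  note Th[simp] = ring_hom_closed[OF T(3)] and Sh[simp] = ring_hom_closed[OF S(3)]
  \<comment> \<open>By adjunction a \<open>T\<close>-linear map \<open>j\<close> from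
    \<open>E'\<close> to \<open>F\<close> corresponds to a \<open>C\<close>-linear map from
    \<open>E'\<close> to \<open>F'\<close>, sending \<open>e\<close> to the function whose value at
    \<open>c\<close> is \<open>j\<close> of \<open>e\<close> times \<open>c\<close>. The map
    \<open>\<iota>\<close> collects these for all \<open>j\<close>.\<close>
  define \<iota> where "\<iota> e = (\<lambda>j\<in>J. \<lambda>c\<in>carrier C. j (e \<triangleleft>\<^bsub>E'\<^esub> c))" for e
  have \<iota>F': "\<iota> e j \<in> carrier F'" if "e \<in> carrier E'" "j \<in> J" for e j
    unfolding \<iota>_def F'_def using that
    by simp (rule coinduced_restrictI[OF C T(1,3)],
        simp_all add: jcl jadd jact E'.rsmult_closed E'.rsmult_r_distr E'.rsmult_assoc)
  have \<iota>: "\<iota> e \<in> carrier ?P" if "e \<in> carrier E'" for e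
    using \<iota>F' that by (auto simp: rmod_prod_def) (auto simp: \<iota>_def)
  have \<iota>app: "\<iota> e j c = j (e \<triangleleft>\<^bsub>E'\<^esub> c)" if "j \<in> J" "c \<in> carrier C" for e j c
    using that by (simp add: \<iota>_def)
  interpret P: right_module C ?P by fact
  have Peq: "p = q" if "p \<in> carrier ?P" "q \<in> carrier ?P"
    "\<And>j c. j \<in> J \<Longrightarrow> c \<in> carrier C \<Longrightarrow> p j c = q j c" for p q
  proof (rule PiE_ext)
    show "p \<in> (\<Pi>\<^sub>E j\<in>J. carrier F')" "q \<in> (\<Pi>\<^sub>E j\<in>J. carrier F')" using that(1,2) by (simp_all add: rmod_prod_def)
    then show "p j = q j" if "j \<in> J" for j
      using coinduced_eqI[of "p j" C T \<psi> F "q j"] \<open>\<And>j c. j \<in> J \<Longrightarrow> c \<in> carrier C \<Longrightarrow> p j c = q j c\<close> that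
      by (auto simp: F'_def dest: PiE_mem)
  qed
  have \<iota>hom: "(\<lambda>e\<in>carrier (rmod_restrict \<phi> E'). \<iota> e) \<in> rmod_hom S (rmod_restrict \<phi> E') (rmod_restrict \<phi> ?P)"
  proof (rule rmod_hom_restrictI[OF E'S]; simp only: rmod_restrict_simps)
    show "\<iota> e \<in> carrier ?P" if "e \<in> carrier E'" for e by (rule \<iota>[OF that])
    show "\<iota> (x \<oplus>\<^bsub>E'\<^esub> y) = \<iota> x \<oplus>\<^bsub>?P\<^esub> \<iota> y" if "x \<in> carrier E'" "y \<in> carrier E'" for x y
    proof (rule Peq)
      fix j c assume jc: "j \<in> J" "c \<in> carrier C"
      then have "(\<iota> x \<oplus>\<^bsub>?P\<^esub> \<iota> y) j c = \<iota> x j c \<oplus>\<^bsub>F\<^esub> \<iota> y j c"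
        by (simp add: rmod_prod_def F'_def coinduced_simps)
      then show "\<iota> (x \<oplus>\<^bsub>E'\<^esub> y) j c = (\<iota> x \<oplus>\<^bsub>?P\<^esub> \<iota> y) j c"
        using jc that by (simp add: \<iota>app E'.rsmult_l_distr jadd E'.rsmult_closed)
    qed (use that \<iota> in simp_all)
    show "\<iota> (x \<triangleleft>\<^bsub>E'\<^esub> \<phi> s) = \<iota> x \<triangleleft>\<^bsub>?P\<^esub> \<phi> s" if "x \<in> carrier E'" "s \<in> carrier S" for x s
    proof (rule Peq)
      fix j c assume jc: "j \<in> J" "c \<in> carrier C"
      then have "(\<iota> x \<triangleleft>\<^bsub>?P\<^esub> \<phi> s) j c = \<iota> x j (\<phi> s \<otimes>\<^bsub>C\<^esub> c)"
        by (simp add: rmod_prod_def F'_def coinduced_simps)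
      then show "\<iota> (x \<triangleleft>\<^bsub>E'\<^esub> \<phi> s) j c = (\<iota> x \<triangleleft>\<^bsub>?P\<^esub> \<phi> s) j c"
        using jc that by (simp add: \<iota>app E'.rsmult_assoc)
    qed (use that \<iota> E'.rsmult_closed P.rsmult_closed in simp_all)
  qed
  \<comment> \<open>A nonzero \<open>e\<close> is detected by some \<open>j\<close> in
    \<open>J\<close>, and \<open>j e\<close> is the value of the component of
    \<open>\<iota> e\<close> at one.\<close>
  have "inj_on (\<lambda>e\<in>carrier (rmod_restrict \<phi> E'). \<iota> e) (carrier (rmod_restrict \<phi> E'))"
  proof (rule rmod_hom_inj_onI[OF E'S PS \<iota>hom]; simp only: rmod_restrict_simps)
    fix e assume e: "e \<in> carrier E'" and 0: "restrict \<iota> (carrier E') e = \<zero>\<^bsub>?P\<^esub>"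
    show "e = \<zero>\<^bsub>E'\<^esub>"
    proof (rule ccontr)
      assume "e \<noteq> \<zero>\<^bsub>E'\<^esub>"
      then obtain j where j: "j \<in> J" "j e \<noteq> \<zero>\<^bsub>F\<^esub>"
        using cogenerator_separates[OF T(1,2) F E'T, of e] e by (auto simp: rmod_restrict_simps J_def)
      have "j e = \<iota> e j \<one>\<^bsub>C\<^esub>" using j e by (simp add: \<iota>app E'.rsmult_one)
      also have "\<dots> = \<zero>\<^bsub>F\<^esub>" using 0 e j by (simp add: rmod_prod_def F'_def coinduced_simps)
      finally show False using j by simp
    qed
  qed
  \<comment> \<open>Evaluation at one is the counit of the adjunction. It is \<open>S\<close>-linear
    because multiplying one by \<open>\<phi> s\<close> on the left or on the right gives the same
    element: the first describes the action on \<open>E'\<close>, the second the linearity of its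
    elements.\<close>
  moreover have "(\<lambda>e\<in>carrier (rmod_restrict \<phi> E'). e \<one>\<^bsub>C\<^esub>) \<in> rmod_hom S (rmod_restrict \<phi> E') E"
  proof (rule rmod_hom_restrictI[OF E'S]; simp only: rmod_restrict_simps)
    show "(x \<triangleleft>\<^bsub>E'\<^esub> \<phi> s) \<one>\<^bsub>C\<^esub> = x \<one>\<^bsub>C\<^esub> \<triangleleft>\<^bsub>E\<^esub> s" if "x \<in> carrier E'" "s \<in> carrier S" for x s
      using that coinduced_act[of x C S \<phi> E "\<one>\<^bsub>C\<^esub>" s] by (simp add: E'_def coinduced_simps)
  qed (simp_all add: E'_def coinduced_simps coinduced_closed)
  \<comment> \<open>Injectivity of \<open>E\<close> extends evaluation at one from the embedded copy
    of \<open>E'\<close> to the whole power.\<close>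
  ultimately obtain \<theta> where "\<theta> \<in> rmod_hom S (rmod_restrict \<phi> ?P) E"
    "\<And>e. e \<in> carrier E' \<Longrightarrow> \<theta> (\<iota> e) = e \<one>\<^bsub>C\<^esub>"
    using injective_extend[OF S(1,2) E E'S PS \<iota>hom, of "\<lambda>e\<in>carrier (rmod_restrict \<phi> E'). e \<one>\<^bsub>C\<^esub>"]
    by (auto simp: rmod_restrict_simps)
  then show ?thesis using that unfolding \<iota>_def by blast
qed

section \<open>A dual module is a summand of a power of any other\<close>

text \<open>The facts about a single duality are collected here so that they can be interpreted
  twice, once for each of the two dualities on the same \<open>M\<close>.\<close>

locale applied_functor =
  fixes R :: "'r ring" and M :: "('r, 'm) module" and S :: "'s ring"
    and \<phi> :: "'s \<Rightarrow> 'm \<Rightarrow> 'm" and E :: "('s, 'e) rmodule"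
  assumes M: "left_module R M" and S: "ring S" and \<phi>: "\<phi> \<in> ring_hom S (End_ring R M)"
    and E: "right_module S E"
begin

abbreviation C where "C \<equiv> End_ring R M"
abbreviation X where "X \<equiv> dual_module M S \<phi> E"
abbreviation E' where "E' \<equiv> coinduced C S \<phi> E"

sublocale M: left_module R M by (rule M)
sublocale S: ring S by (rule S)
sublocale E: right_module S E by (rule E)
sublocale C: ring C by (rule ring_End_ring[OF M])
sublocale E': right_module C E' by (rule right_module_coinduced[OF C.ring_axioms S \<phi> E])
sublocale X: right_module R X
  by (rule right_module_dual[OF M right_module_of_hom[OF M S \<phi>] E rmod_of_hom_smult[OF M S \<phi>]])

lemma \<phi>_closed: "s \<in> carrier S \<Longrightarrow> \<phi> s \<in> carrier C"
  by (rule ring_hom_closed[OF \<phi>])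

lemma C_closed: "\<lbrakk>c \<in> carrier C; m \<in> carrier M\<rbrakk> \<Longrightarrow> c m \<in> carrier M"
  and C_add: "\<lbrakk>c \<in> carrier C; m \<in> carrier M; n \<in> carrier M\<rbrakk> \<Longrightarrow> c (m \<oplus>\<^bsub>M\<^esub> n) = c m \<oplus>\<^bsub>M\<^esub> c n"
  and C_smult: "\<lbrakk>c \<in> carrier C; r \<in> carrier R; m \<in> carrier M\<rbrakk> \<Longrightarrow> c (r \<odot>\<^bsub>M\<^esub> m) = r \<odot>\<^bsub>M\<^esub> c m"
  by (simp_all add: End_ring_simps lmod_hom_closed[of c R M M] lmod_hom_add[of c R M M]
      lmod_hom_smult[of c R M M])

lemmas X_closed = dual_module_closed[of _ M S \<phi> E] and X_add = dual_module_add[of _ M S \<phi> E]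
  and X_act = dual_module_act[of _ M S \<phi> E]

text \<open>The \<open>C\<close>-linear map \<open>M \<rightarrow> E'\<close> adjoint to \<open>f\<close>.\<close>

definition adj :: "('m \<Rightarrow> 'e) \<Rightarrow> 'm \<Rightarrow> ('m \<Rightarrow> 'm) \<Rightarrow> 'e"
  where "adj f m = (\<lambda>c\<in>carrier C. f (c m))"

lemma adj_closed:
  assumes "f \<in> carrier X" "m \<in> carrier M"
  shows "adj f m \<in> carrier E'"
  unfolding adj_def
proof (rule coinduced_restrictI[OF C.ring_axioms S \<phi>])
  show "f ((c \<otimes>\<^bsub>C\<^esub> \<phi> s) m) = f (c m) \<triangleleft>\<^bsub>E\<^esub> s" if "c \<in> carrier C" "s \<in> carrier S" for c s
    using that assms X_act[of f "c m" s] by (simp add: End_ring_simps(2) C_closed)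
qed (use assms in \<open>simp_all add: X_closed X_add C_closed End_ring_simps(5)\<close>)

lemma adj_add_left:
  assumes "f \<in> carrier X" "g \<in> carrier X" "m \<in> carrier M"
  shows "adj (f \<oplus>\<^bsub>X\<^esub> g) m = adj f m \<oplus>\<^bsub>E'\<^esub> adj g m"
  by (rule coinduced_eqI[of _ C S \<phi> E])
    (use assms in \<open>simp_all add: adj_closed coinduced_simps\<close>,
      simp add: adj_def dual_module_simps C_closed)

lemma adj_add_right:
  assumes "f \<in> carrier X" "m \<in> carrier M" "n \<in> carrier M"
  shows "adj f (m \<oplus>\<^bsub>M\<^esub> n) = adj f m \<oplus>\<^bsub>E'\<^esub> adj f n"
  by (rule coinduced_eqI[of _ C S \<phi> E])
    (use assms in \<open>simp_all add: adj_closed coinduced_simps\<close>,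
      simp add: adj_def X_add C_closed C_add)

text \<open>Evaluated at \<open>d\<close>, both sides give \<open>f (d (c m))\<close>. This depends
  on the convention that the product of \<open>c\<close> and \<open>d\<close> in
  \<open>End_ring\<close> applies \<open>c\<close> first.\<close>

lemma adj_act:
  assumes "f \<in> carrier X" "m \<in> carrier M" "c \<in> carrier C"
  shows "adj f (c m) = adj f m \<triangleleft>\<^bsub>E'\<^esub> c"
  by (rule coinduced_eqI[of _ C S \<phi> E])
    (use assms in \<open>simp_all add: adj_closed coinduced_simps C_closed E'.rsmult_closed\<close>,
      simp add: adj_def End_ring_simps(2))

lemma adj_smult:
  assumes "f \<in> carrier X" "m \<in> carrier M" "r \<in> carrier R"
  shows "adj (f \<triangleleft>\<^bsub>X\<^esub> r) m = adj f (r \<odot>\<^bsub>M\<^esub> m)"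
  using assms by (auto simp: adj_def dual_module_simps C_closed C_smult)

end

text \<open>This is \<open>Hom\<^sub>C(M, -)\<close> applied to the splitting of \<open>E'\<close>
  in a power of \<open>F'\<close>, written out on elements. That power is indexed by
  \<open>J\<close>, but each \<open>j\<close> in \<open>J\<close> induces a homomorphism from
  \<open>X\<close> to \<open>Y\<close>. Pulling families back along this assignment starts the
  retraction from \<open>hom_power R X Y\<close>, whatever \<open>J\<close> is, and on evaluation
  families it gives back \<open>f\<close>.\<close>

lemma dual_retraction:
  fixes R :: "'r ring" and M :: "('r, 'm) module"
    and S :: "'s ring" and \<phi> :: "'s \<Rightarrow> 'm \<Rightarrow> 'm" and E :: "('s, 'e) rmodule"
    and T :: "'t ring" and \<psi> :: "'t \<Rightarrow> 'm \<Rightarrow> 'm" and F :: "('t, 'f) rmodule"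
  assumes M: "left_module R M"
    and star: "duality_applies TYPE('u) R M S \<phi> E" and S: "carrier S \<lesssim> (UNIV :: 'u set)"
    and sharp: "duality_applies TYPE('u) R M T \<psi> F" and T: "carrier T \<lesssim> (UNIV :: 'u set)"
  defines "X \<equiv> dual_module M S \<phi> E" and "Y \<equiv> dual_module M T \<psi> F"
  obtains \<sigma> where "\<sigma> \<in> rmod_hom R (hom_power R X Y) X"
    and "\<And>f. f \<in> carrier X \<Longrightarrow> \<sigma> (\<lambda>h\<in>rmod_hom R X Y. h f) = f"
proof -
  define C where "C = End_ring R M"
  have Sr: "ring S" "\<phi> \<in> ring_hom S C" and E: "rmod_injective TYPE('u) S E"
    and Tr: "ring T" "\<psi> \<in> ring_hom T C" and F: "rmod_injective TYPE('u) T F" "rmod_cogenerator TYPE('u) T F"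
    using star sharp by (simp_all add: duality_applies_def C_def)
  interpret X: applied_functor R M S \<phi> E
    by (rule applied_functor.intro[OF M Sr[unfolded C_def]]) (use E in \<open>simp add: rmod_injective_def\<close>)
  interpret Y: applied_functor R M T \<psi> F
    by (rule applied_functor.intro[OF M Tr[unfolded C_def]]) (use F in \<open>simp add: rmod_injective_def\<close>)
  define E' where "E' = coinduced C S \<phi> E"
  define F' where "F' = coinduced C T \<psi> F"
  define J where "J = rmod_hom T (rmod_restrict \<psi> E') F"
  define P where "P = rmod_prod J (\<lambda>_. F')"
  obtain \<theta> where \<theta>: "\<theta> \<in> rmod_hom S (rmod_restrict \<phi> P) E"
    and \<theta>1: "\<And>e. e \<in> carrier E' \<Longrightarrow> \<theta> (\<lambda>j\<in>J. \<lambda>c\<in>carrier C. j (e \<triangleleft>\<^bsub>E'\<^esub> c)) = e \<one>\<^bsub>C\<^esub>"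
    using coinduced_retraction[OF X.C.ring_axioms Sr(1) S X.\<phi> Tr(1) T Y.\<phi> E F]
    unfolding E'_def F'_def J_def C_def P_def by blast
  note Xf = X.X_closed X.X_add X.X_act X.adj_closed X.adj_add_left X.adj_add_right X.adj_act X.adj_smult
    X.C_closed X.\<phi>_closed
  note Xf[folded C_def, folded X_def E'_def, simp]
  note Yf = Y.X_closed Y.X_add Y.X_act Y.adj_closed Y.adj_add_left Y.adj_add_right Y.adj_act Y.adj_smult
    Y.\<phi>_closed
  note Yf[folded C_def, folded Y_def F'_def, simp]

  have j_add[simp]: "j (x \<oplus>\<^bsub>E'\<^esub> y) = j x \<oplus>\<^bsub>F\<^esub> j y" if "j \<in> J" "x \<in> carrier E'" "y \<in> carrier E'" for j x y
    using that rmod_hom_add[of j T "rmod_restrict \<psi> E'" F x y] by (simp add: J_def rmod_restrict_simps)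
  have j_closed[simp]: "j x \<in> carrier F" if "j \<in> J" "x \<in> carrier E'" for j x
    using that rmod_hom_closed[of j T "rmod_restrict \<psi> E'" F x] by (simp add: J_def rmod_restrict_simps)
  have j_act[simp]: "j (x \<triangleleft>\<^bsub>E'\<^esub> \<psi> t) = j x \<triangleleft>\<^bsub>F\<^esub> t" if "j \<in> J" "x \<in> carrier E'" "t \<in> carrier T" for j x t
    using that rmod_hom_rsmult[of j T "rmod_restrict \<psi> E'" F x t] by (simp add: J_def rmod_restrict_simps)
  note XR = X.X.right_module_axioms[folded X_def] and YR = Y.X.right_module_axioms[folded Y_def]
  let ?H = "rmod_hom R X Y"
  \<comment> \<open>\<open>\<Phi> j\<close> is the effect of \<open>j\<close> on duals:
    \<open>f\<close> becomes a map from \<open>M\<close> to \<open>E'\<close> by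
    \<open>X.adj\<close>, and composing with \<open>j\<close> ends in \<open>F\<close>.\<close>
  define \<Phi> where "\<Phi> j = (\<lambda>f\<in>carrier X. \<lambda>m\<in>carrier M. j (X.adj f m))" for j :: "(('m \<Rightarrow> 'm) \<Rightarrow> 'e) \<Rightarrow> 'f"
  have \<Phi>: "\<Phi> j \<in> ?H" if j: "j \<in> J" for j
    unfolding \<Phi>_def
  proof (rule rmod_hom_restrictI[OF XR])
    show "(\<lambda>m\<in>carrier M. j (X.adj f m)) \<in> carrier Y" if f: "f \<in> carrier X" for f
      unfolding Y_def
    proof (rule dual_module_restrictI[OF right_module_of_hom[OF M Tr(1) Y.\<phi>]])
      show "j (X.adj f (\<psi> t m)) = j (X.adj f m) \<triangleleft>\<^bsub>F\<^esub> t" if "m \<in> carrier M" "t \<in> carrier T" for m t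
        using that f j by simp
    qed (use f j in simp_all)
  qed (use j in \<open>auto simp: Y_def dual_module_def X.M.smult_closed intro!: restrict_ext\<close>)
  \<comment> \<open>A family \<open>y\<close> is read at the indices \<open>\<Phi> j\<close>, and
    each entry is turned into a map from \<open>M\<close> to \<open>F'\<close>. Together they give,
    for fixed \<open>y\<close>, a \<open>C\<close>-linear map from \<open>M\<close> to
    \<open>P\<close>, which \<open>\<theta>\<close> then sends to \<open>E\<close>.\<close>
  define \<tau> where "\<tau> y m = (\<lambda>j\<in>J. Y.adj (y (\<Phi> j)) m)" for y m
  have hp: "carrier (hom_power R X Y) = (\<Pi>\<^sub>E h\<in>?H. carrier Y)"
    by (simp add: hom_power_def rmod_prod_def)
  have yY[simp]: "y (\<Phi> j) \<in> carrier Y" if "y \<in> carrier (hom_power R X Y)" "j \<in> J" for y j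
    using that \<Phi> by (auto simp: hp)
  have \<tau>P: "\<tau> y m \<in> carrier P" if "y \<in> carrier (hom_power R X Y)" "m \<in> carrier M" for y m
    using that by (auto simp: \<tau>_def P_def rmod_prod_def)
  have \<theta>_add: "\<theta> (p \<oplus>\<^bsub>P\<^esub> q) = \<theta> p \<oplus>\<^bsub>E\<^esub> \<theta> q" if "p \<in> carrier P" "q \<in> carrier P" for p q
    using that rmod_hom_add[OF \<theta>, of p q] by (simp add: rmod_restrict_simps)
  have \<theta>_closed: "\<theta> p \<in> carrier E" if "p \<in> carrier P" for p
    using that rmod_hom_closed[OF \<theta>, of p] by (simp add: rmod_restrict_simps)
  have \<theta>_act: "\<theta> (p \<triangleleft>\<^bsub>P\<^esub> \<phi> s) = \<theta> p \<triangleleft>\<^bsub>E\<^esub> s" if "p \<in> carrier P" "s \<in> carrier S" for p s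
    using that rmod_hom_rsmult[OF \<theta>, of p s] by (simp add: rmod_restrict_simps)
  define \<sigma> where "\<sigma> = (\<lambda>y\<in>carrier (hom_power R X Y). \<lambda>m\<in>carrier M. \<theta> (\<tau> y m))"
  have \<sigma>X: "(\<lambda>m\<in>carrier M. \<theta> (\<tau> y m)) \<in> carrier X" if y: "y \<in> carrier (hom_power R X Y)" for y
    unfolding X_def
  proof (rule dual_module_restrictI[OF right_module_of_hom[OF M Sr(1) X.\<phi>]])
    show "\<theta> (\<tau> y m) \<in> carrier E" if "m \<in> carrier M" for m
      using that y by (simp add: \<tau>P \<theta>_closed)
    show "\<theta> (\<tau> y (m \<oplus>\<^bsub>M\<^esub> n)) = \<theta> (\<tau> y m) \<oplus>\<^bsub>E\<^esub> \<theta> (\<tau> y n)" if mn: "m \<in> carrier M" "n \<in> carrier M" for m n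
    proof -
      have "\<tau> y (m \<oplus>\<^bsub>M\<^esub> n) = \<tau> y m \<oplus>\<^bsub>P\<^esub> \<tau> y n"
        using mn y by (auto simp: \<tau>_def P_def rmod_prod_def intro!: restrict_ext)
      then show ?thesis using mn y by (simp add: \<theta>_add \<tau>P)
    qed
    show "\<theta> (\<tau> y (\<phi> s m)) = \<theta> (\<tau> y m) \<triangleleft>\<^bsub>E\<^esub> s" if ms: "m \<in> carrier M" "s \<in> carrier S" for m s
    proof -
      have "\<tau> y (\<phi> s m) = \<tau> y m \<triangleleft>\<^bsub>P\<^esub> \<phi> s"
        using ms y by (auto simp: \<tau>_def P_def rmod_prod_def intro!: restrict_ext)
      then show ?thesis using ms y by (simp add: \<theta>_act \<tau>P)
    qed
  qed
  show ?thesis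
  proof
    show "\<sigma> \<in> rmod_hom R (hom_power R X Y) X"
      unfolding \<sigma>_def
    proof (rule rmod_hom_restrictI[OF _ \<sigma>X])
      show "right_module R (hom_power R X Y)"
        unfolding hom_power_def by (rule right_module_prod[OF X.M.R.ring_axioms YR])
      fix y assume y: "y \<in> carrier (hom_power R X Y)"
      show "(\<lambda>m\<in>carrier M. \<theta> (\<tau> (y \<oplus>\<^bsub>hom_power R X Y\<^esub> z) m)) =
        (\<lambda>m\<in>carrier M. \<theta> (\<tau> y m)) \<oplus>\<^bsub>X\<^esub> (\<lambda>m\<in>carrier M. \<theta> (\<tau> z m))"
        if z: "z \<in> carrier (hom_power R X Y)" for z
      proof -
        have "\<tau> (y \<oplus>\<^bsub>hom_power R X Y\<^esub> z) m = \<tau> y m \<oplus>\<^bsub>P\<^esub> \<tau> z m" if "m \<in> carrier M" for m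
          using that y z \<Phi> by (auto simp: \<tau>_def P_def hom_power_def rmod_prod_def intro!: restrict_ext)
        then show ?thesis using y z
          by (auto simp: X_def dual_module_def \<theta>_add \<tau>P intro!: restrict_ext)
      qed
      show "(\<lambda>m\<in>carrier M. \<theta> (\<tau> (y \<triangleleft>\<^bsub>hom_power R X Y\<^esub> r) m)) = (\<lambda>m\<in>carrier M. \<theta> (\<tau> y m)) \<triangleleft>\<^bsub>X\<^esub> r"
        if r: "r \<in> carrier R" for r
      proof -
        have "\<tau> (y \<triangleleft>\<^bsub>hom_power R X Y\<^esub> r) m = \<tau> y (r \<odot>\<^bsub>M\<^esub> m)" if "m \<in> carrier M" for m
          using that y r \<Phi> by (auto simp: \<tau>_def hom_power_def rmod_prod_def intro!: restrict_ext)
        then show ?thesis using y r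
          by (auto simp: X_def dual_module_def X.M.smult_closed intro!: restrict_ext)
      qed
    qed
    fix f assume f: "f \<in> carrier X"
    let ?ev = "\<lambda>h\<in>?H. h f"
    have ev: "?ev \<in> carrier (hom_power R X Y)" using f rmod_hom_closed[of _ R X Y f] by (simp add: hp)
    show "\<sigma> ?ev = f"
    proof (rule dual_module_eqI[of _ M S \<phi> E, folded X_def])
      show "\<sigma> ?ev \<in> carrier X" using \<sigma>X[OF ev] ev by (simp add: \<sigma>_def)
      fix m assume m: "m \<in> carrier M"
      \<comment> \<open>On an evaluation family, \<open>\<tau>\<close> produces exactly the embedded
        image of \<open>X.adj f m\<close> in \<open>P\<close>, where \<open>\<theta>\<close> is
        known to be evaluation at one; and \<open>X.adj f m\<close> at one is
        \<open>f m\<close>.\<close>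
      have "\<tau> ?ev m = (\<lambda>j\<in>J. \<lambda>c\<in>carrier C. j (X.adj f m \<triangleleft>\<^bsub>E'\<^esub> c))"
        using m f \<Phi> by (auto simp: \<tau>_def Y.adj_def \<Phi>_def C_def[symmetric] intro!: restrict_ext)
      then have "\<theta> (\<tau> ?ev m) = X.adj f m \<one>\<^bsub>C\<^esub>" using \<theta>1 f m by simp
      also have "\<dots> = f m" using m by (simp add: X.adj_def C_def End_ring_simps(3))
      finally show "\<sigma> ?ev m = f m" using ev m by (simp add: \<sigma>_def)
    qed (rule f)
  qed
qed

section \<open>Summands of powers belong to the closure\<close>

text \<open>A retraction splits: \<open>P\<close> is the image of \<open>\<alpha>\<close> plus the
  kernel \<open>K\<close> of \<open>\<beta>\<close>. The complement is exhibited because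
  \<open>Prod.summand\<close> asks for one in the same universe, and a submodule of \<open>P\<close>
  qualifies.\<close>

lemma rmod_iso_split:
  fixes P :: "('r, 'p) rmodule"
  assumes N: "right_module R N" and P: "right_module R P"
    and \<alpha>: "\<alpha> \<in> rmod_hom R N P" and \<beta>: "\<beta> \<in> rmod_hom R P N"
    and \<beta>\<alpha>: "\<And>n. n \<in> carrier N \<Longrightarrow> \<beta> (\<alpha> n) = n"
  defines "K \<equiv> P\<lparr>carrier := {p \<in> carrier P. \<beta> p = \<zero>\<^bsub>N\<^esub>}\<rparr>"
  shows "right_module R K" and "rmod_iso R (rmod_sum N K) P"
proof -
  interpret N: right_module R N by fact
  interpret P: right_module R P by fact
  note [simp] = rmod_hom_closed[OF \<alpha>] rmod_hom_closed[OF \<beta>] rmod_hom_add[OF \<alpha>] rmod_hom_add[OF \<beta>]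
    rmod_hom_rsmult[OF \<alpha>] rmod_hom_rsmult[OF \<beta>] rmod_hom_zero[OF N P \<alpha>] rmod_hom_zero[OF P N \<beta>]
    N.rsmult_closed P.rsmult_closed N.zero_rsmult \<beta>\<alpha>
  have "rsubmodule R P {p \<in> carrier P. \<beta> p = \<zero>\<^bsub>N\<^esub>}" by (simp add: rsubmodule_def)
  then show K: "right_module R K" unfolding K_def by (rule right_module_rsubmodule[OF P])
  let ?f = "\<lambda>x\<in>carrier (rmod_sum N K). \<alpha> (fst x) \<oplus>\<^bsub>P\<^esub> snd x"
  have "?f \<in> rmod_hom R (rmod_sum N K) P"
    by (rule rmod_hom_restrictI[OF right_module_sum[OF N K]])
      (auto simp: rmod_sum_def K_def P.M.a_ac P.rsmult_l_distr)
  moreover have "bij_betw ?f (carrier (rmod_sum N K)) (carrier P)"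
    unfolding bij_betw_def
  proof
    have "n = n' \<and> k = k'" if "n \<in> carrier N" "n' \<in> carrier N" "k \<in> carrier P" "k' \<in> carrier P"
      "\<beta> k = \<zero>\<^bsub>N\<^esub>" "\<beta> k' = \<zero>\<^bsub>N\<^esub>" "\<alpha> n \<oplus>\<^bsub>P\<^esub> k = \<alpha> n' \<oplus>\<^bsub>P\<^esub> k'" for n n' k k'
    proof -
      have "\<beta> (\<alpha> n \<oplus>\<^bsub>P\<^esub> k) = n" "\<beta> (\<alpha> n' \<oplus>\<^bsub>P\<^esub> k') = n'" using that(1-6) by simp_all
      then have n: "n = n'" using that(7) by simp
      then have "k \<oplus>\<^bsub>P\<^esub> \<alpha> n = k' \<oplus>\<^bsub>P\<^esub> \<alpha> n" using that by (simp add: P.M.a_comm)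
      then show ?thesis using n that(1,3,4) P.M.add.right_cancel by simp
    qed
    then show "inj_on ?f (carrier (rmod_sum N K))" by (auto simp: inj_on_def rmod_sum_def K_def)
    have "p \<in> ?f ` carrier (rmod_sum N K)" if p: "p \<in> carrier P" for p
    proof
      \<comment> \<open>The kernel component of \<open>p\<close> is the difference of
        \<open>p\<close> and \<open>\<alpha> (\<beta> p)\<close>, with subtraction expressed through
        the action of minus one.\<close>
      let ?k = "p \<oplus>\<^bsub>P\<^esub> \<alpha> (\<beta> p) \<triangleleft>\<^bsub>P\<^esub> (\<ominus>\<^bsub>R\<^esub> \<one>\<^bsub>R\<^esub>)"
      have "\<beta> ?k = \<beta> p \<triangleleft>\<^bsub>N\<^esub> (\<ominus>\<^bsub>R\<^esub> \<one>\<^bsub>R\<^esub>) \<oplus>\<^bsub>N\<^esub> \<beta> p" using p by (simp add: N.M.a_comm)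
      also have "\<dots> = \<zero>\<^bsub>N\<^esub>" using p by (simp add: N.rsmult_minus_one)
      finally show mem: "(\<beta> p, ?k) \<in> carrier (rmod_sum N K)" using p by (simp add: rmod_sum_def K_def)
      have "\<alpha> (\<beta> p) \<oplus>\<^bsub>P\<^esub> ?k = (\<alpha> (\<beta> p) \<triangleleft>\<^bsub>P\<^esub> (\<ominus>\<^bsub>R\<^esub> \<one>\<^bsub>R\<^esub>) \<oplus>\<^bsub>P\<^esub> \<alpha> (\<beta> p)) \<oplus>\<^bsub>P\<^esub> p"
        using p by (simp add: P.M.a_ac del: rmod_hom_rsmult[OF \<alpha>] rmod_hom_rsmult[OF \<beta>])
      also have "\<dots> = p" using p by (simp add: P.rsmult_minus_one)
      finally show "p = ?f (\<beta> p, ?k)" using mem by simp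
    qed
    then show "?f ` carrier (rmod_sum N K) = carrier P" by (auto simp: rmod_sum_def K_def)
  qed
  ultimately show "rmod_iso R (rmod_sum N K) P" unfolding rmod_iso_def by blast
qed

text \<open>It lets the index set and the factor of a power be replaced by copies inside
  \<open>'u\<close>, as the rule \<open>Prod.product\<close> demands.\<close>

lemma rmod_iso_power_reindex:
  assumes R: "ring R" and Z: "right_module R Z" and k: "bij_betw k H I" and iso: "rmod_iso R Z Y"
  shows "rmod_iso R (rmod_prod I (\<lambda>_. Z)) (rmod_prod H (\<lambda>_. Y))"
proof -
  obtain u where u: "u \<in> rmod_hom R Z Y" "bij_betw u (carrier Z) (carrier Y)"
    using iso by (auto simp: rmod_iso_def)
  have PR: "right_module R (rmod_prod I (\<lambda>_. Z))" by (rule right_module_prod[OF R Z])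
  have kI: "k h \<in> I" if "h \<in> H" for h using k that by (auto simp: bij_betw_def)
  let ?P = "rmod_prod I (\<lambda>_. Z)" and ?Q = "rmod_prod H (\<lambda>_. Y)"
  define g where "g = (\<lambda>x\<in>carrier ?P. \<lambda>h\<in>H. u (x (k h)))"
  have xk: "x (k h) \<in> carrier Z" if "x \<in> carrier ?P" "h \<in> H" for x h
    using that kI by (auto simp: rmod_prod_def)
  have g: "g \<in> rmod_hom R ?P ?Q"
    unfolding g_def
  proof (rule rmod_hom_restrictI[OF PR])
    show "(\<lambda>h\<in>H. u (x (k h))) \<in> carrier ?Q" if "x \<in> carrier ?P" for x
      using xk[OF that] rmod_hom_closed[OF u(1)] by (auto simp: rmod_prod_def)
    show "(\<lambda>h\<in>H. u ((x \<oplus>\<^bsub>?P\<^esub> y) (k h))) = (\<lambda>h\<in>H. u (x (k h))) \<oplus>\<^bsub>?Q\<^esub> (\<lambda>h\<in>H. u (y (k h)))"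
      if "x \<in> carrier ?P" "y \<in> carrier ?P" for x y
      using xk[OF that(1)] xk[OF that(2)] kI
      by (simp add: rmod_prod_def rmod_hom_add[OF u(1)] cong: restrict_cong)
    show "(\<lambda>h\<in>H. u ((x \<triangleleft>\<^bsub>?P\<^esub> r) (k h))) = (\<lambda>h\<in>H. u (x (k h))) \<triangleleft>\<^bsub>?Q\<^esub> r"
      if "x \<in> carrier ?P" "r \<in> carrier R" for x r
      using xk[OF that(1)] that(2) kI
      by (simp add: rmod_prod_def rmod_hom_rsmult[OF u(1)] cong: restrict_cong)
  qed
  have "bij_betw g (carrier ?P) (carrier ?Q)"
    unfolding bij_betw_def
  proof
    show "inj_on g (carrier ?P)"
    proof (rule inj_onI)
      fix x y assume xy: "x \<in> carrier ?P" "y \<in> carrier ?P" "g x = g y"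
      show "x = y"
      proof (rule PiE_ext)
        show "x \<in> (\<Pi>\<^sub>E i\<in>I. carrier Z)" "y \<in> (\<Pi>\<^sub>E i\<in>I. carrier Z)" using xy(1,2) by (simp_all add: rmod_prod_def)
        fix i assume "i \<in> I"
        then obtain h where h: "h \<in> H" "i = k h" using k by (auto simp: bij_betw_def)
        have "u (x (k h)) = u (y (k h))" using fun_cong[OF xy(3), of h] xy(1,2) h by (simp add: g_def)
        then show "x i = y i" using xk[OF xy(1) h(1)] xk[OF xy(2) h(1)] u(2) h by (auto simp: bij_betw_def dest: inj_onD)
      qed
    qed
    have "z \<in> g ` carrier ?P" if z: "z \<in> carrier ?Q" for z
    proof
      let ?x = "\<lambda>i\<in>I. inv_into (carrier Z) u (z (inv_into H k i))"
      have z': "z h \<in> u ` carrier Z" if "h \<in> H" for h using z that u(2) by (auto simp: rmod_prod_def bij_betw_def)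
      have inv: "inv_into H k i \<in> H" if "i \<in> I" for i using that k by (auto simp: bij_betw_def inv_into_into)
      show x: "?x \<in> carrier ?P" using inv z' by (auto simp: rmod_prod_def inv_into_into)
      have "g ?x = (\<lambda>h\<in>H. z h)"
        using x kI k z' by (auto simp: g_def bij_betw_def f_inv_into_f intro!: restrict_ext)
      also have "\<dots> = z" using z by (auto simp: rmod_prod_def)
      finally show "z = g ?x" by simp
    qed
    then show "g ` carrier ?P = carrier ?Q" using rmod_hom_closed[OF g] by blast
  qed
  with g show ?thesis by (auto simp: rmod_iso_def)
qed

text \<open>Only the power itself is assumed to fit into \<open>'u\<close>. A nonzero element of
  \<open>Y\<close> embeds \<open>H\<close> into the power by families supported at one index, and an
  index in \<open>H\<close> embeds \<open>Y\<close> by constant families. Thus \<open>ne\<close>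
  brings both the index set and the factor into \<open>'u\<close>.\<close>

lemma power_copies_subset_Prod:
  fixes Y :: "('r, 'y) rmodule" and H :: "'h set"
  assumes Y: "right_module R Y" and ne: "H \<noteq> {}" "carrier Y \<noteq> {\<zero>\<^bsub>Y\<^esub>}"
    and univ: "carrier (rmod_prod H (\<lambda>_. Y)) \<lesssim> (UNIV :: 'u set)"
  shows "(copies R (rmod_prod H (\<lambda>_. Y)) :: ('r, 'u) rmodule set) \<subseteq> Prod_of R Y"
proof
  interpret Y: right_module R Y by fact
  let ?P = "rmod_prod H (\<lambda>_. Y)"
  fix P :: "('r, 'u) rmodule" assume "P \<in> copies R ?P"
  then have P: "right_module R P" "rmod_iso R ?P P" by (auto simp: copies_def)
  obtain y where y: "y \<in> carrier Y" "y \<noteq> \<zero>\<^bsub>Y\<^esub>"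
    using ne(2) Y.M.zero_closed by blast
  have "(\<lambda>h. \<lambda>h'\<in>H. if h' = h then y else \<zero>\<^bsub>Y\<^esub>) ` H \<subseteq> carrier ?P"
    using y by (intro image_subsetI) (simp add: rmod_prod_def restrict_PiE_iff)
  moreover have "inj_on (\<lambda>h. \<lambda>h'\<in>H. if h' = h then y else \<zero>\<^bsub>Y\<^esub>) H"
  proof (rule inj_onI)
    fix h h' assume "h \<in> H" "h' \<in> H"
      and "(\<lambda>h''\<in>H. if h'' = h then y else \<zero>\<^bsub>Y\<^esub>) = (\<lambda>h''\<in>H. if h'' = h' then y else \<zero>\<^bsub>Y\<^esub>)"
    from fun_cong[OF this(3), of h] this(1) show "h = h'" using y by (simp split: if_splits)
  qed
  ultimately have "H \<lesssim> carrier ?P" by (auto simp: lepoll_def)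
  then have "H \<lesssim> (UNIV :: 'u set)" using univ by (rule lepoll_trans)
  then obtain k :: "'h \<Rightarrow> 'u" where k: "inj_on k H" by (auto simp: lepoll_def)
  obtain h0 where h0: "h0 \<in> H" using ne by blast
  have "inj_on (\<lambda>y. \<lambda>h\<in>H. y) (carrier Y)" by (rule inj_onI) (metis h0 restrict_apply')
  moreover have "(\<lambda>y. \<lambda>h\<in>H. y) ` carrier Y \<subseteq> carrier ?P" by (auto simp: rmod_prod_def)
  ultimately have "carrier Y \<lesssim> carrier ?P" by (auto simp: lepoll_def)
  then have "carrier Y \<lesssim> (UNIV :: 'u set)" using univ by (rule lepoll_trans)
  then obtain Z :: "('r, 'u) rmodule" where Z: "Z \<in> copies R Y" by (rule copies_nonempty[OF Y])
  then have ZR: "right_module R Z" and YZ: "rmod_iso R Y Z" by (auto simp: copies_def)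
  have "rmod_iso R (rmod_prod (k ` H) (\<lambda>_. Z)) ?P"
    by (rule rmod_iso_power_reindex[OF Y.R.ring_axioms ZR _ rmod_iso_sym[OF Y ZR YZ]])
      (use k in \<open>simp add: bij_betw_def\<close>)
  then have "rmod_iso R (rmod_prod (k ` H) (\<lambda>_. Z)) P"
    using rmod_iso_trans[OF right_module_prod[OF Y.R.ring_axioms ZR]] P(2) by blast
  then show "P \<in> Prod_of R Y"
    by (rule Prod.product[OF Prod.base[OF Z] P(1)])
qed

text \<open>Evaluation embeds \<open>X\<close> in the power of \<open>Y\<close> indexed by all
  homomorphisms, and \<open>\<sigma>\<close> splits it, so a copy of \<open>X\<close> is a summand
  of a copy of the power. The case of zero \<open>Y\<close> is separate because the zero power says
  nothing about the size of its index set.\<close>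

lemma copies_subset_Prod:
  fixes X :: "('r, 'x) rmodule" and Y :: "('r, 'y) rmodule"
  assumes X: "right_module R X" and Y: "right_module R Y"
    and univ: "carrier (hom_power R X Y) \<lesssim> (UNIV :: 'u set)"
    and \<sigma>: "\<sigma> \<in> rmod_hom R (hom_power R X Y) X"
      "\<And>x. x \<in> carrier X \<Longrightarrow> \<sigma> (\<lambda>h\<in>rmod_hom R X Y. h x) = x"
  shows "(copies R X :: ('r, 'u) rmodule set) \<subseteq> Prod_of R Y"
proof
  interpret X: right_module R X by fact
  interpret Y: right_module R Y by fact
  let ?H = "rmod_hom R X Y"
  fix N :: "('r, 'u) rmodule" assume "N \<in> copies R X"
  then have N: "right_module R N" and XN: "rmod_iso R X N" by (auto simp: copies_def)
  have zero: "(\<lambda>x\<in>carrier X. \<zero>\<^bsub>Y\<^esub>) \<in> ?H"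
    by (rule rmod_hom_restrictI[OF X]) (simp_all add: Y.zero_rsmult)
  show "N \<in> Prod_of R Y"
  proof (cases "carrier Y = {\<zero>\<^bsub>Y\<^esub>}")
    case True
    \<comment> \<open>All evaluation families coincide when \<open>Y\<close> is zero, and
      \<open>\<sigma>\<close> recovers \<open>x\<close> from its family; so \<open>X\<close> is zero
      too and \<open>N\<close> is a copy of \<open>Y\<close> already.\<close>
    have "x = x'" if "x \<in> carrier X" "x' \<in> carrier X" for x x'
    proof -
      have "h x = h x'" if "h \<in> ?H" for h
        using rmod_hom_closed[OF that \<open>x \<in> carrier X\<close>] rmod_hom_closed[OF that \<open>x' \<in> carrier X\<close>] True by simp
      then have "(\<lambda>h\<in>?H. h x) = (\<lambda>h\<in>?H. h x')" by (rule restrict_ext)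
      then show ?thesis using \<sigma>(2)[OF that(1)] \<sigma>(2)[OF that(2)] by metis
    qed
    then have "carrier X = {\<zero>\<^bsub>X\<^esub>}" by blast
    then have "bij_betw (\<lambda>x\<in>carrier X. \<zero>\<^bsub>Y\<^esub>) (carrier X) (carrier Y)" using True by (simp add: bij_betw_def)
    then have "rmod_iso R X Y" using zero unfolding rmod_iso_def by blast
    then have "rmod_iso R Y N" using rmod_iso_trans[OF Y rmod_iso_sym[OF X Y] XN] by blast
    then show ?thesis using N by (intro Prod.base) (simp add: copies_def)
  next
    case False
    let ?W = "hom_power R X Y"
    have W: "right_module R ?W" unfolding hom_power_def by (rule right_module_prod[OF X.R.ring_axioms Y])
    obtain P :: "('r, 'u) rmodule" where P: "P \<in> copies R ?W" by (rule copies_nonempty[OF W univ])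
    then have PR: "right_module R P" by (simp add: copies_def)
    have "P \<in> Prod_of R Y"
      using power_copies_subset_Prod[OF Y _ False univ[unfolded hom_power_def]] zero P
      unfolding hom_power_def by blast
    obtain i where i: "i \<in> rmod_hom R X N" "bij_betw i (carrier X) (carrier N)"
      using XN by (auto simp: rmod_iso_def)
    obtain p where p: "p \<in> rmod_hom R ?W P" "bij_betw p (carrier ?W) (carrier P)"
      using P by (auto simp: copies_def rmod_iso_def)
    let ?i' = "\<lambda>n\<in>carrier N. inv_into (carrier X) i n" and ?p' = "\<lambda>w\<in>carrier P. inv_into (carrier ?W) p w"
    note i' = rmod_hom_inv_into[OF X N i] and p' = rmod_hom_inv_into[OF W PR p]
    let ?ev = "\<lambda>x\<in>carrier X. \<lambda>h\<in>?H. h x"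
    have ev: "?ev \<in> rmod_hom R X ?W"
      by (rule rmod_hom_restrictI[OF X])
        (auto simp: hom_power_def rmod_prod_def rmod_hom_closed rmod_hom_add rmod_hom_rsmult intro!: restrict_ext)
    \<comment> \<open>Evaluation and its retraction are conjugated by the isomorphisms
      \<open>i\<close> and \<open>p\<close>, so that the splitting takes place between the copies
      \<open>N\<close> and \<open>P\<close> in \<open>'u\<close>.\<close>
    let ?\<alpha> = "compose (carrier N) (compose (carrier X) p ?ev) ?i'"
    let ?\<beta> = "compose (carrier P) (compose (carrier ?W) i \<sigma>) ?p'"
    have \<alpha>: "?\<alpha> \<in> rmod_hom R N P"
      by (rule rmod_hom_compose[OF N i' rmod_hom_compose[OF X ev p(1)]])
    have \<beta>: "?\<beta> \<in> rmod_hom R P N"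
      by (rule rmod_hom_compose[OF PR p' rmod_hom_compose[OF W \<sigma>(1) i(1)]])
    have "?\<beta> (?\<alpha> n) = n" if n: "n \<in> carrier N" for n
    proof -
      let ?x = "inv_into (carrier X) i n"
      have x: "?x \<in> carrier X" and ix: "i ?x = n"
        using n i(2) by (auto simp: bij_betw_def inv_into_into f_inv_into_f)
      have w: "?ev ?x \<in> carrier ?W" by (rule rmod_hom_closed[OF ev x])
      have "?\<alpha> n = p (?ev ?x)" using n x by (simp add: compose_def)
      moreover have "p (?ev ?x) \<in> carrier P" by (rule rmod_hom_closed[OF p(1) w])
      moreover have "inv_into (carrier ?W) p (p (?ev ?x)) = ?ev ?x"
        using p(2) w by (simp only: bij_betw_def inv_into_f_f)
      ultimately have "?\<beta> (?\<alpha> n) = i (\<sigma> (?ev ?x))" using w by (simp add: compose_def)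
      then show ?thesis using \<sigma>(2)[OF x] x ix by simp
    qed
    from rmod_iso_split[OF N PR \<alpha> \<beta> this] show ?thesis
      by (intro Prod.summand[OF \<open>P \<in> Prod_of R Y\<close> N])
  qed
qed

section \<open>Comparison of the two closures\<close>

lemma Prod_subset:
  assumes "\<X> \<subseteq> Prod R \<Y>"
  shows "Prod R \<X> \<subseteq> Prod R \<Y>"
proof
  fix N assume "N \<in> Prod R \<X>"
  then show "N \<in> Prod R \<Y>"
  proof induction
    case (base N)
    then show ?case using assms by blast
  qed (blast intro: Prod.intros)+
qed

lemma right_module_dual_of_duality:
  fixes R :: "'r ring" and S :: "'s ring"
  assumes "left_module R M" "duality_applies U R M S \<phi> E"
  shows "right_module R (dual_module M S \<phi> E)"
proof -
  interpret applied_functor R M S \<phi> E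
    using assms by (simp add: applied_functor_def duality_applies_def rmod_injective_def)
  show ?thesis by (rule X.right_module_axioms)
qed

text \<open>Each inclusion is obtained by splitting one dual off a power of the other. The two
  inclusions use different powers, and a copy of each must exist in \<open>'u\<close>; hence the
  symmetric pair of size hypotheses.\<close>

theorem theorem3p2:
  fixes R :: "'r ring" and M :: "('r, 'm) module"
    and S :: "'s ring" and \<phi> :: "'s \<Rightarrow> 'm \<Rightarrow> 'm" and E :: "('s, 'e) rmodule"
    and T :: "'t ring" and \<psi> :: "'t \<Rightarrow> 'm \<Rightarrow> 'm" and F :: "('t, 'f) rmodule"
  assumes M: "left_module R M"
    and star: "duality_applies TYPE('u) R M S \<phi> E"
    and sharp: "duality_applies TYPE('u) R M T \<psi> F"
    and S_in_universe: "carrier S \<lesssim> (UNIV :: 'u set)"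
    and T_in_universe: "carrier T \<lesssim> (UNIV :: 'u set)"
    and star_sharp_in_universe:
      "carrier (hom_power R (dual_module M S \<phi> E) (dual_module M T \<psi> F)) \<lesssim> (UNIV :: 'u set)"
    and sharp_star_in_universe:
      "carrier (hom_power R (dual_module M T \<psi> F) (dual_module M S \<phi> E)) \<lesssim> (UNIV :: 'u set)"
  shows "(Prod_of R (dual_module M S \<phi> E) :: ('r, 'u) rmodule set) = Prod_of R (dual_module M T \<psi> F)"
proof -
  let ?X = "dual_module M S \<phi> E" and ?Y = "dual_module M T \<psi> F"
  note X = right_module_dual_of_duality[OF M star] and Y = right_module_dual_of_duality[OF M sharp]
  obtain \<sigma> where \<sigma>: "\<sigma> \<in> rmod_hom R (hom_power R ?X ?Y) ?X"
    "\<And>f. f \<in> carrier ?X \<Longrightarrow> \<sigma> (\<lambda>h\<in>rmod_hom R ?X ?Y. h f) = f"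
    using dual_retraction[OF M star S_in_universe sharp T_in_universe] by blast
  have 1: "(copies R ?X :: ('r, 'u) rmodule set) \<subseteq> Prod_of R ?Y"
    by (rule copies_subset_Prod[OF X Y star_sharp_in_universe \<sigma>(1)]) (rule \<sigma>(2))
  obtain \<tau> where \<tau>: "\<tau> \<in> rmod_hom R (hom_power R ?Y ?X) ?Y"
    "\<And>f. f \<in> carrier ?Y \<Longrightarrow> \<tau> (\<lambda>h\<in>rmod_hom R ?Y ?X. h f) = f"
    using dual_retraction[OF M sharp T_in_universe star S_in_universe] by blast
  have 2: "(copies R ?Y :: ('r, 'u) rmodule set) \<subseteq> Prod_of R ?X"
    by (rule copies_subset_Prod[OF Y X sharp_star_in_universe \<tau>(1)]) (rule \<tau>(2))
  show ?thesis using Prod_subset[OF 1] Prod_subset[OF 2] by blast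
qed

end
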